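(* There is an algorithm that, given any instance $\langle G,k,\mathsf{init},\mathsf{fin}\rangle$ of Snake Game, returns in time $\mathcal{O}(|V(G)|^3)$ an equivalent instance $\langle G',k,\mathsf{init},\mathsf{fin}\rangle$ of Snake Game (with the same $k$, $\mathsf{init}$, $\mathsf{fin}$) such that $G'$ has treewidth $k^{\mathcal{O}(1)}$.
   Context: For an undirected graph $G$ and $k\in\mathbb{N}$, a $(G,k)$-configuration is a tuple $(v_1,\dots,v_k)$ of pairwise distinct vertices with $\{v_i,v_{i+1}\}\in E(G)$ for $1\le i\le k-1$. A pair of configurations $((v_1,\dots,v_k),(v'_1,\dots,v'_k))$ is a $1$-transition if $v'_1\ne v_i$ for $1\le i\le k-1$ and $v'_i=v_{i-1}$ for $2\le i\le k$; $\mathsf{conf}$ can reach $\mathsf{conf}'$ if there is a sequence $\mathsf{conf}=\mathsf{conf}_1,\dots,\mathsf{conf}_{\ell+1}=\mathsf{conf}'$, $\ell\ge1$, of configurations with each consecutive pair a $1$-transition. An instance $\langle G,k,\mathsf{init},\mathsf{fin}\rangle$ of Snake Game ($G$ undirected graph, $k\in\mathbb{N}$, $\mathsf{init},\mathsf{fin}$ configurations) is a Yes-instance iff $\mathsf{init}$ can reach $\mathsf{fin}$; two instances are equivalent if both are Yes-instances or both are No-instances. "Treewidth $k^{\mathcal{O}(1)}$" means treewidth at most $c\cdot k^{c}$ for an absolute constant $c$. *)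

theory Defs
  imports Complex_Main "HOL-Library.Landau_Symbols"
begin

section \<open>Graphs\<close>

record 'a ugraph =
  verts :: "'a set"
  edges :: "'a set set"

definition finite_graph :: "'a ugraph \<Rightarrow> bool" where
  "finite_graph G \<longleftrightarrow> finite (verts G) \<and> (\<forall>e\<in>edges G. e \<subseteq> verts G \<and> card e = 2)"

text \<open>The empty list counts as a path here, because it is the only configuration of size 0.\<close>

definition is_path :: "'a ugraph \<Rightarrow> 'a list \<Rightarrow> bool" where
  "is_path G p \<longleftrightarrow> set p \<subseteq> verts G \<and> distinct p \<and> successively (\<lambda>u v. {u, v} \<in> edges G) p"

definition connected_graph :: "'a ugraph \<Rightarrow> bool" where
  "connected_graph G \<longleftrightarrow> verts G \<noteq> {} \<and>
     (\<forall>u\<in>verts G. \<forall>v\<in>verts G. \<exists>p. is_path G p \<and> p \<noteq> [] \<and> hd p = u \<and> last p = v)"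

definition is_cycle :: "'a ugraph \<Rightarrow> 'a list \<Rightarrow> bool" where
  "is_cycle G p \<longleftrightarrow> is_path G p \<and> length p \<ge> 3 \<and> {last p, hd p} \<in> edges G"

definition is_tree :: "'a ugraph \<Rightarrow> bool" where
  "is_tree T \<longleftrightarrow> finite_graph T \<and> connected_graph T \<and> (\<nexists>p. is_cycle T p)"

definition induced :: "'a ugraph \<Rightarrow> 'a set \<Rightarrow> 'a ugraph" where
  "induced G X = \<lparr>verts = verts G \<inter> X, edges = {e \<in> edges G. e \<subseteq> X}\<rparr>"


section \<open>Treewidth\<close>

definition tree_decomposition :: "'a ugraph \<Rightarrow> 't ugraph \<Rightarrow> ('t \<Rightarrow> 'a set) \<Rightarrow> bool" where
  "tree_decomposition G T bag \<longleftrightarrow>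
     is_tree T \<and>
     (\<forall>t\<in>verts T. bag t \<subseteq> verts G) \<and>
     (\<forall>e\<in>edges G. \<exists>t\<in>verts T. e \<subseteq> bag t) \<and>
     (\<forall>v\<in>verts G. connected_graph (induced T {t \<in> verts T. v \<in> bag t}))"

text \<open>
  The subtraction is on natural numbers, so the empty graph has treewidth 0 and not -1.
  Decomposition trees are finite, so natural numbers suffice as their nodes.
\<close>

definition width :: "'t ugraph \<Rightarrow> ('t \<Rightarrow> 'a set) \<Rightarrow> nat" where
  "width T bag = Max ((\<lambda>t. card (bag t)) ` verts T) - 1"

definition treewidth :: "'a ugraph \<Rightarrow> nat" where
  "treewidth G = (LEAST w. \<exists>(T :: nat ugraph) bag. tree_decomposition G T bag \<and> width T bag = w)"


section \<open>Snake Game\<close>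

definition is_conf :: "'a ugraph \<Rightarrow> nat \<Rightarrow> 'a list \<Rightarrow> bool" where
  "is_conf G k c \<longleftrightarrow> length c = k \<and> is_path G c"

text \<open>
  Positions are counted from 0. As in the definition for tuples, adjacency of the new head to
  the old one is enforced only by the second list being a configuration; for \<open>k = 1\<close> the snake
  may therefore move to any vertex.
\<close>

definition transition :: "'a ugraph \<Rightarrow> nat \<Rightarrow> 'a list \<Rightarrow> 'a list \<Rightarrow> bool" where
  "transition G k c c' \<longleftrightarrow> is_conf G k c \<and> is_conf G k c' \<and>
     (\<forall>i<k - 1. c' ! 0 \<noteq> c ! i) \<and> (\<forall>i. 1 \<le> i \<and> i < k \<longrightarrow> c' ! i = c ! (i - 1))"

text \<open>At least one transition has to be made, even if the two configurations are equal.\<close>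

definition can_reach :: "'a ugraph \<Rightarrow> nat \<Rightarrow> 'a list \<Rightarrow> 'a list \<Rightarrow> bool" where
  "can_reach G k = (transition G k)\<^sup>+\<^sup>+"

definition snake_instance :: "'a ugraph \<Rightarrow> nat \<Rightarrow> 'a list \<Rightarrow> 'a list \<Rightarrow> bool" where
  "snake_instance G k ini fin \<longleftrightarrow> finite_graph G \<and> is_conf G k ini \<and> is_conf G k fin"

definition yes_instance :: "'a ugraph \<Rightarrow> nat \<Rightarrow> 'a list \<Rightarrow> 'a list \<Rightarrow> bool" where
  "yes_instance G k ini fin \<longleftrightarrow> snake_instance G k ini fin \<and> can_reach G k ini fin"


section \<open>A word RAM\<close>

text \<open>
  Structured programs for a random access machine with a register file (a program mentions only
  finitely many registers) and a memory that is addressed by register contents. Every elementary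
  instruction and every test of a condition takes one unit of time. Since unbounded
  integers at unit cost would be unrealistically powerful, execution is relative to a word bound
  \<open>W\<close>: an instruction that would produce a value, or use an address, not below \<open>W\<close> has no
  execution. Subtraction is truncated and division rounds down.
\<close>

datatype operand = Const nat | Reg nat

datatype arith_op = Add | Sub | Mul | Div

datatype cond = Less operand operand | Equal operand operand

datatype program =
    Skip
  | Compute nat arith_op operand operand
  | Load nat operand
  | Store operand operand
  | Seq program program
  | Branch cond program program
  | While cond program

fun operand_val :: "(nat \<Rightarrow> nat) \<Rightarrow> operand \<Rightarrow> nat" where
  "operand_val R (Const n) = n"
| "operand_val R (Reg r) = R r"

fun arith_val :: "arith_op \<Rightarrow> nat \<Rightarrow> nat \<Rightarrow> nat" where
  "arith_val Add x y = x + y"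
| "arith_val Sub x y = x - y"
| "arith_val Mul x y = x * y"
| "arith_val Div x y = x div y"

fun cond_val :: "(nat \<Rightarrow> nat) \<Rightarrow> cond \<Rightarrow> bool" where
  "cond_val R (Less a b) \<longleftrightarrow> operand_val R a < operand_val R b"
| "cond_val R (Equal a b) \<longleftrightarrow> operand_val R a = operand_val R b"

text \<open>\<open>exec W P (R, M) t (R', M')\<close>: started with registers \<open>R\<close> and memory \<open>M\<close>, the program \<open>P\<close>
  halts after exactly \<open>t\<close> steps with registers \<open>R'\<close> and memory \<open>M'\<close>.\<close>

inductive exec :: "nat \<Rightarrow> program \<Rightarrow> (nat \<Rightarrow> nat) \<times> (nat \<Rightarrow> nat) \<Rightarrow> nat \<Rightarrow>
    (nat \<Rightarrow> nat) \<times> (nat \<Rightarrow> nat) \<Rightarrow> bool" for W where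
  Skip: "exec W Skip s 1 s"
| Compute: "x = arith_val f (operand_val R a) (operand_val R b) \<Longrightarrow> x < W \<Longrightarrow>
    exec W (Compute r f a b) (R, M) 1 (R(r := x), M)"
| Load: "operand_val R a < W \<Longrightarrow>
    exec W (Load r a) (R, M) 1 (R(r := M (operand_val R a)), M)"
| Store: "operand_val R a < W \<Longrightarrow> operand_val R b < W \<Longrightarrow>
    exec W (Store a b) (R, M) 1 (R, M(operand_val R a := operand_val R b))"
| Seq: "exec W P s t s' \<Longrightarrow> exec W Q s' t' s'' \<Longrightarrow> exec W (Seq P Q) s (t + t') s''"
| BranchTrue: "cond_val (fst s) b \<Longrightarrow> exec W P s t s' \<Longrightarrow> exec W (Branch b P Q) s (1 + t) s'"
| BranchFalse: "\<not> cond_val (fst s) b \<Longrightarrow> exec W Q s t s' \<Longrightarrow> exec W (Branch b P Q) s (1 + t) s'"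
| WhileFalse: "\<not> cond_val (fst s) b \<Longrightarrow> exec W (While b P) s 1 s"
| WhileTrue: "cond_val (fst s) b \<Longrightarrow> exec W P s t s' \<Longrightarrow> exec W (While b P) s' t' s'' \<Longrightarrow>
    exec W (While b P) s (1 + t + t') s''"

lemma exec_deterministic:
  "exec W P s t s' \<Longrightarrow> exec W P s u s'' \<Longrightarrow> u = t \<and> s'' = s'"
proof (induction arbitrary: u s'' rule: exec.induct)
  case (Skip s)
  from Skip.prems show ?case by cases simp
next
  case (Compute x f R a b r M)
  from Compute.prems show ?case by cases (simp add: Compute.hyps)
next
  case (Load R a r M)
  from Load.prems show ?case by cases simp
next
  case (Store R a b M)
  from Store.prems show ?case by cases simp
next
  case (Seq P s t s' Q t' s3)
  from Seq.prems show ?case by cases (use Seq.IH in blast)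
next
  case (BranchTrue s b P t s' Q)
  from BranchTrue.prems show ?case by cases (use BranchTrue.IH BranchTrue.hyps in blast)+
next
  case (BranchFalse s b Q t s' P)
  from BranchFalse.prems show ?case by cases (use BranchFalse.IH BranchFalse.hyps in blast)+
next
  case (WhileFalse s b P)
  from WhileFalse.prems show ?case by cases (use WhileFalse.hyps in simp_all)
next
  case (WhileTrue s b P t s' t' s3)
  from WhileTrue.prems show ?case by cases (use WhileTrue.IH WhileTrue.hyps in blast)+
qed

definition initial_state :: "nat list \<Rightarrow> (nat \<Rightarrow> nat) \<times> (nat \<Rightarrow> nat)" where
  "initial_state xs = ((\<lambda>_. 0), (\<lambda>i. if i < length xs then xs ! i else 0))"

definition memory_starts_with :: "(nat \<Rightarrow> nat) \<times> (nat \<Rightarrow> nat) \<Rightarrow> nat list \<Rightarrow> bool" where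
  "memory_starts_with s ys \<longleftrightarrow> (\<forall>i<length ys. snd s i = ys ! i)"

text \<open>
  Words have a constant factor \<open>d\<close> more bits than the largest number in the input.
\<close>

definition word_bound :: "nat \<Rightarrow> nat list \<Rightarrow> nat" where
  "word_bound d xs = (Max (set xs) + 2) ^ d"

text \<open>
  The algorithm \<open>P\<close>, with words of a length governed by \<open>d\<close>, transforms the input \<open>xs\<close>
  into the output \<open>ys\<close> in at most \<open>t\<close> steps.
\<close>

definition outputs_within :: "program \<Rightarrow> nat \<Rightarrow> nat list \<Rightarrow> nat \<Rightarrow> nat list \<Rightarrow> bool" where
  "outputs_within P d xs t ys \<longleftrightarrow>
     (\<exists>t'\<le>t. \<exists>s. exec (word_bound d xs) P (initial_state xs) t' s \<and> memory_starts_with s ys)"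


section \<open>Instances as inputs and outputs\<close>

text \<open>
  Vertices are natural numbers. An encoded instance consists of the number of vertices, \<open>k\<close>, the
  vertices in some order \<open>vs\<close>, the two configurations, and the rows of the adjacency matrix
  with respect to \<open>vs\<close>. Its length is determined by its first two entries.
\<close>

definition instance_code :: "nat list \<Rightarrow> nat ugraph \<Rightarrow> nat \<Rightarrow> nat list \<Rightarrow> nat list \<Rightarrow> nat list" where
  "instance_code vs G k ini fin =
     [length vs, k] @ vs @ ini @ fin @
     concat (map (\<lambda>u. map (\<lambda>v. if {u, v} \<in> edges G then 1 else 0) vs) vs)"

definition encodes_instance :: "nat list \<Rightarrow> nat ugraph \<Rightarrow> nat \<Rightarrow> nat list \<Rightarrow> nat list \<Rightarrow> bool" where
  "encodes_instance xs G k ini fin \<longleftrightarrow>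
     (\<exists>vs. distinct vs \<and> set vs = verts G \<and> xs = instance_code vs G k ini fin)"

end

theory Submission
  imports Defs
begin

text \<open>
  A cycle \<open>X\<close> of more than \<open>k\<close> vertices that avoids \<open>ini\<close> and \<open>fin\<close> can be shortened by
  contracting one of its edges. A snake whose head first reaches \<open>X\<close> can run around the cycle in
  either direction, and by time reversal a snake that ends in \<open>fin\<close> and has been in \<open>X\<close> can come
  from any position on it. So if \<open>X\<close> is reachable from \<open>ini\<close> and, reversed, from \<open>fin\<close>, then both
  graphs give Yes-instances, and otherwise \<open>X\<close> is irrelevant in both.

  Such cycles are found by depth-first search outside \<open>ini\<close> and \<open>fin\<close>: a back edge to a
  vertex at least \<open>k\<close> below the top of the stack closes one. If no such back edge is left, every
  vertex together with the \<open>k\<close> topmost vertices of the stack and the vertices of \<open>ini\<close> and \<open>fin\<close>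
  forms a bag of a tree decomposition of width at most \<open>3 * k\<close>. A contraction isolates a vertex,
  so there are at most \<open>n\<close> searches, each of \<open>O(n)\<close> steps that scan one row of the adjacency matrix.
  Contracted vertices stay in the graph as isolated vertices, so that only the matrix changes.
\<close>

section \<open>Moves of the snake\<close>

text \<open>Suppose two graphs agree outside \<open>X\<close>, and follow a run of the snake in one
  of them. If the run meets \<open>X\<close>, it is cut at the first entry and, read backwards in
  time, at the last exit. At both cuts only a head lies in \<open>X\<close>, so in the other graph
  both snakes can be wound onto a cycle. The backward snake uses the reversed cycle: undoing the
  time reversal then makes both directions of travel agree, and circling joins the two pieces. The
  entry vertex may have lost its edges, so the head is redirected to a cycle vertex adjacent to the
  neck. This needs a neck, so \<open>k \<le> 1\<close> is treated separately. One transfer lemma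
  serves both directions of the equivalence.

  The search tests for long back edges before it pushes a vertex, so it never holds one. As usual in
  depth-first search, visited neighbours of a new vertex are on the stack (or in \<open>ini\<close>
  or \<open>fin\<close>); this is what the tree decomposition rests on. A contraction gives new
  edges to visited vertices and spoils this, hence the restart.\<close>

lemma is_path_append:
  "is_path G (p @ q) \<longleftrightarrow> is_path G p \<and> is_path G q \<and> set p \<inter> set q = {} \<and>
     (p \<noteq> [] \<longrightarrow> q \<noteq> [] \<longrightarrow> {last p, hd q} \<in> edges G)"
  by (auto simp: is_path_def successively_append_iff)

lemma is_path_Cons:
  "is_path G (x # q) \<longleftrightarrow> x \<in> verts G \<and> is_path G q \<and> x \<notin> set q \<and> (q \<noteq> [] \<longrightarrow> {x, hd q} \<in> edges G)"
  by (auto simp: is_path_def successively_Cons)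

lemma is_path_Nil: "is_path G []"
  by (simp add: is_path_def)

lemma is_path_rev: "is_path G (rev p) \<longleftrightarrow> is_path G p"
  by (simp add: is_path_def insert_commute)

lemma is_path_take: "is_path G p \<Longrightarrow> is_path G (take k p)"
  by (metis append_take_drop_id is_path_append)

lemma is_path_butlast: "is_path G p \<Longrightarrow> is_path G (butlast p)"
  by (simp add: butlast_conv_take is_path_take)

lemma is_conf_rev: "is_conf G k (rev c) \<longleftrightarrow> is_conf G k c"
  by (simp add: is_conf_def is_path_rev)

text \<open>Once the new configuration is repetition-free, its head cannot lie on the part of the
  old body that survives the shift. A move is then just a shift between two configurations.\<close>

lemma transition_iff:
  assumes "1 \<le> k"
  shows "transition G k c c' \<longleftrightarrow> is_conf G k c \<and> is_conf G k c' \<and> tl c' = butlast c"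
proof -
  have shift: "(\<forall>i. 1 \<le> i \<and> i < k \<longrightarrow> c' ! i = c ! (i - 1)) \<longleftrightarrow> tl c' = butlast c"
    if "length c = k" "length c' = k"
  proof -
    have "(\<forall>i. 1 \<le> i \<and> i < k \<longrightarrow> c' ! i = c ! (i - 1)) \<longleftrightarrow> (\<forall>i<k - 1. c' ! Suc i = c ! i)"
    proof (intro iffI allI impI)
      fix i assume "\<forall>i<k - 1. c' ! Suc i = c ! i" "1 \<le> i \<and> i < k"
      then show "c' ! i = c ! (i - 1)" by (cases i) auto
    qed auto
    also have "\<dots> \<longleftrightarrow> tl c' = butlast c"
      using that by (simp add: list_eq_iff_nth_eq nth_tl nth_butlast)
    finally show ?thesis .
  qed
  have head: "c' ! 0 \<noteq> c ! i"
    if "is_conf G k c" "is_conf G k c'" "tl c' = butlast c" "i < k - 1" for i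
  proof -
    have len: "length c = k" "length c' = k" and d: "distinct c'"
      using that by (auto simp: is_conf_def is_path_def)
    have "c ! i = c' ! Suc i"
      using that(3,4) len by (metis length_butlast nth_butlast nth_tl)
    moreover have "Suc i < k" using that(4) by simp
    ultimately show ?thesis using d len assms by (auto simp: nth_eq_iff_index_eq)
  qed
  show ?thesis
    unfolding transition_def using shift head by (auto simp: is_conf_def)
qed

lemma transition_Cons:
  assumes "is_conf G k c" "1 \<le> k" "is_path G (x # butlast c)"
  shows "transition G k c (x # butlast c)"
  using assms by (auto simp: transition_iff is_conf_def)

text \<open>Reversing the list exchanges head and tail, so a move played backwards in time is a move
  of the reversed snake.\<close>

lemma transition_rev:
  assumes "transition G k c c'" "1 \<le> k"
  shows "transition G k (rev c') (rev c)"
proof -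
  have *: "is_conf G k c" "is_conf G k c'" "tl c' = butlast c"
    using assms by (auto simp: transition_iff)
  moreover have "tl (rev c) = rev (butlast c)" by (metis butlast_rev rev_rev_ident rev_swap)
  moreover have "butlast (rev c') = rev (tl c')" by (simp add: butlast_rev)
  ultimately show ?thesis using assms(2) by (simp add: transition_iff is_conf_rev)
qed

lemma transition_rtranclp_rev:
  assumes "(transition G k)\<^sup>*\<^sup>* c c'" "1 \<le> k"
  shows "(transition G k)\<^sup>*\<^sup>* (rev c') (rev c)"
  using assms by (induction rule: rtranclp_induct) (auto intro: converse_rtranclp_into_rtranclp dest: transition_rev)

lemma transition_tranclp_rev:
  assumes "(transition G k)\<^sup>+\<^sup>+ c c'" "1 \<le> k"
  shows "(transition G k)\<^sup>+\<^sup>+ (rev c') (rev c)"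
  using assms
  by (induction rule: tranclp_induct) (blast intro: tranclp_into_tranclp2 tranclp.r_into_trancl dest: transition_rev)+

text \<open>Lists begin with the head, so \<open>q\<close> lies in front of the snake
  \<open>c\<close> and is traversed from its end to its beginning.\<close>

lemma transition_along_path:
  assumes "is_path G (q @ c)" "length c = k" "1 \<le> k"
  shows "(transition G k)\<^sup>*\<^sup>* c (take k (q @ c))"
  using assms
proof (induction q)
  case (Cons a q)
  let ?p = "take k (q @ c)"
  have path: "is_path G (q @ c)" using Cons.prems by (simp add: is_path_Cons)
  have conf: "is_conf G k ?p"
    using is_path_take[OF path, of k] Cons.prems by (simp add: is_conf_def del: take_append)
  obtain k' where k': "k = Suc k'" using Cons.prems by (cases k) auto
  have len: "length (q @ c) \<ge> Suc k'" using Cons.prems k' by simp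
  have eq: "take k (a # q @ c) = a # butlast ?p"
    using butlast_take[OF len] k' by simp
  have "transition G k ?p (take k (a # q @ c))"
    unfolding eq
    by (rule transition_Cons[OF conf Cons.prems(3)])
      (use eq is_path_take[OF Cons.prems(1), of k] in \<open>simp del: take_append\<close>)
  then show ?case using Cons path by (auto intro: rtranclp.rtrancl_into_rtrancl)
qed simp

text \<open>Unlike \<open>is_cycle\<close>, this includes the two-vertex list of an edge, on which a snake of
  length 2 can turn around.\<close>

definition closed_path :: "'a ugraph \<Rightarrow> 'a list \<Rightarrow> bool" where
  "closed_path G C \<longleftrightarrow> is_path G C \<and> C \<noteq> [] \<and> {last C, hd C} \<in> edges G"

section \<open>Motion around a cycle\<close>

lemma closed_path_rotate1: "closed_path G C \<Longrightarrow> closed_path G (rotate1 C)"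
  by (cases C; cases "tl C") (auto simp: closed_path_def is_path_Cons is_path_append is_path_Nil split: if_splits)

lemma closed_path_rotate: "closed_path G C \<Longrightarrow> closed_path G (rotate m C)"
  by (induction m) (simp_all add: closed_path_rotate1)

lemma closed_path_rev: "closed_path G C \<Longrightarrow> closed_path G (rev C)"
  by (simp add: closed_path_def is_path_rev hd_rev last_rev insert_commute)

text \<open>The head steps onto \<open>hd C\<close>. If \<open>k = length C\<close>, the tail leaves
  this vertex in the same move, which the rules permit.\<close>

lemma transition_rotate1:
  assumes "closed_path G C" "k \<le> length C" "1 \<le> k"
  shows "transition G k (take k (rotate1 C)) (take k C)"
proof -
  have C: "is_path G C" "is_path G (rotate1 C)" "C \<noteq> []"
    using assms(1) closed_path_rotate1 by (auto simp: closed_path_def)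
  obtain k' where k': "k = Suc k'" using assms by (cases k) auto
  obtain x C' where xC: "C = x # C'" using C by (cases C) auto
  have "Suc k' \<le> length (rotate1 C)" using assms k' by simp
  then have "butlast (take k (rotate1 C)) = take k' (rotate1 C)"
    using butlast_take[of k "rotate1 C"] k' by simp
  moreover have "k' \<le> length C'" using assms(2) k' xC by simp
  ultimately have "tl (take k C) = butlast (take k (rotate1 C))" using k' xC by simp
  then show ?thesis
    using C assms by (simp add: transition_iff is_conf_def is_path_take)
qed

lemma rtranclp_rotate:
  assumes "closed_path G C" "k \<le> length C" "1 \<le> k"
  shows "(transition G k)\<^sup>*\<^sup>* (take k (rotate m C)) (take k C)"
proof (induction m)
  case (Suc m)
  have "transition G k (take k (rotate1 (rotate m C))) (take k (rotate m C))"
    by (rule transition_rotate1) (use assms closed_path_rotate in auto)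
  then show ?case using Suc by (simp add: converse_rtranclp_into_rtranclp)
qed simp

lemma rotate_undo: "\<exists>m'. rotate m' (rotate m C) = C"
proof (cases "C = []")
  case False
  have "rotate (length C - m mod length C) (rotate (m mod length C) C) = C"
    using False by (simp add: rotate_rotate)
  then show ?thesis by (metis rotate_conv_mod)
qed simp

text \<open>The snake circles in one direction only, but rotations of a list have finite order, so
  going on in that direction reaches every position.\<close>

lemma rtranclp_rotate_rotate:
  assumes "closed_path G C" "k \<le> length C" "1 \<le> k"
  shows "(transition G k)\<^sup>*\<^sup>* (take k (rotate m C)) (take k (rotate m' C))"
proof -
  obtain j where j: "rotate j (rotate m' C) = C" using rotate_undo by blast
  have "(transition G k)\<^sup>*\<^sup>* (take k (rotate (m + j) (rotate m' C))) (take k (rotate m' C))"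
    by (rule rtranclp_rotate) (use assms closed_path_rotate in auto)
  then show ?thesis by (simp add: j flip: rotate_rotate)
qed

text \<open>With \<open>C\<close> rotated so that \<open>x\<close> comes last, the rest of the cycle
  is a path in front of the head. It remains a path when \<open>ys\<close> is appended, because
  \<open>ys\<close> avoids \<open>C\<close>.\<close>

lemma enter_closed_path:
  assumes "closed_path G C" "k \<le> length C" "is_conf G k (x # ys)" "x \<in> set C" "set ys \<inter> set C = {}"
  shows "\<exists>m. (transition G k)\<^sup>*\<^sup>* (x # ys) (take k (rotate m C))"
proof -
  obtain as bs where C: "C = as @ x # bs" using assms(4) by (auto simp: in_set_conv_decomp)
  have "rotate (length (as @ [x])) C = (bs @ as) @ [x]"
    using rotate_append[of "as @ [x]" bs] C by simp
  then obtain m where m: "rotate m C = (bs @ as) @ [x]" by blast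
  have cl: "is_path G ((bs @ as) @ [x])"
    using closed_path_rotate[OF assms(1), of m] m by (simp add: closed_path_def)
  have k: "length (x # ys) = k" "is_path G (x # ys)" using assms(3) by (auto simp: is_conf_def)
  have "is_path G (((bs @ as) @ [x]) @ ys)"
    using cl k assms(5) C by (subst is_path_append) (auto simp: is_path_Cons)
  then have "(transition G k)\<^sup>*\<^sup>* (x # ys) (take k ((bs @ as) @ x # ys))"
    using k by (intro transition_along_path) auto
  \<comment> \<open>The path in front of \<open>x\<close> has \<open>length C - 1\<close> vertices,
    at least \<open>k - 1\<close>. So of the old snake at most \<open>x\<close> is left among the
    first \<open>k\<close> vertices.\<close>
  moreover have "k - (length bs + length as) = 0 \<or> k - (length bs + length as) = 1"
    using assms(2) C by auto
  then have "take k ((bs @ as) @ x # ys) = take k (rotate m C)"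
    using m by auto
  ultimately show ?thesis by metis
qed

section \<open>Transfer of runs between graphs that agree outside a set \<open>X\<close>\<close>

text \<open>The run is copied until its head first enters \<open>X\<close>. The vertex entered may
  have no suitable edge in \<open>H\<close>, so the head is sent to some \<open>q\<close> on
  \<open>C\<close> next to the neck instead. Hence \<open>C\<close> may be smaller than
  \<open>X\<close>, as it is after a contraction.\<close>

lemma tranclp_avoid_or_hit:
  assumes reach: "(transition G k)\<^sup>+\<^sup>+ ini c" and k: "2 \<le> k"
    and ini: "set ini \<inter> X = {}"
    and verts: "verts G = verts H"
    and out: "\<And>e. e \<in> edges G \<Longrightarrow> e \<inter> X = {} \<Longrightarrow> e \<in> edges H"
    and touch: "\<And>v x. v \<notin> X \<Longrightarrow> x \<in> X \<Longrightarrow> {x, v} \<in> edges G \<Longrightarrow> \<exists>q\<in>set C. {q, v} \<in> edges H"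
    and C: "set C \<subseteq> X" "set C \<subseteq> verts H"
  shows "(transition H k)\<^sup>+\<^sup>+ ini c \<and> set c \<inter> X = {} \<or>
    (\<exists>q ys. (transition H k)\<^sup>+\<^sup>+ ini (q # ys) \<and> is_conf H k (q # ys) \<and> q \<in> set C \<and> set ys \<inter> X = {})"
proof -
  have path: "is_path H p" if "is_path G p" "set p \<inter> X = {}" for p
    using that
  proof (induction p)
    case (Cons a p)
    then show ?case
      using verts out[of "{a, hd p}"] by (cases p) (auto simp: is_path_Cons)
  qed (simp add: is_path_def)
  have single: "transition H k c c' \<and> set c' \<inter> X = {} \<or>
      (\<exists>q ys. transition H k c (q # ys) \<and> is_conf H k (q # ys) \<and> q \<in> set C \<and> set ys \<inter> X = {})"
    if t: "transition G k c c'" and c: "set c \<inter> X = {}" for c c'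
  proof -
    have cc: "is_conf G k c" "is_conf G k c'" "tl c' = butlast c" using t k by (auto simp: transition_iff)
    have confc: "is_conf H k c" using cc path c by (auto simp: is_conf_def)
    obtain x where x: "c' = x # butlast c" using cc k by (cases c') (auto simp: is_conf_def)
    have but: "set (butlast c) \<inter> X = {}" using c by (auto dest: in_set_butlastD)
    show ?thesis
    proof (cases "x \<in> X")
      case False
      then have "is_conf H k c'" using x but path[of c'] cc by (auto simp: is_conf_def)
      then show ?thesis using confc cc x but k False by (auto simp: transition_iff)
    next
      case True
      \<comment> \<open>A snake of at least two vertices has a neck behind its new head. It lies
        outside \<open>X\<close>, as \<open>touch\<close> demands.\<close>
      have ne: "butlast c \<noteq> []" using cc k by (auto simp: is_conf_def butlast_conv_take)
      have "hd (butlast c) \<notin> X" using ne but hd_in_set by blast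
      moreover have "{x, hd (butlast c)} \<in> edges G"
        using cc(2) x ne by (auto simp: is_conf_def is_path_Cons)
      ultimately obtain q where q: "q \<in> set C" "{q, hd (butlast c)} \<in> edges H"
        using touch True by blast
      have "is_path H (q # butlast c)"
        using q C but confc by (auto simp: is_path_Cons is_conf_def is_path_butlast)
      moreover from this have "transition H k c (q # butlast c)"
        using confc k by (intro transition_Cons) auto
      ultimately show ?thesis using q but cc x by (auto simp: is_conf_def)
    qed
  qed
  from reach show ?thesis
  proof (induction rule: tranclp_induct)
    case (base c)
    from single[OF base ini] show ?case by (blast intro: tranclp.r_into_trancl)
  next
    case (step c c')
    from step.IH show ?case
    proof (elim disjE)
      assume *: "(transition H k)\<^sup>+\<^sup>+ ini c \<and> set c \<inter> X = {}"
      from single[OF step.hyps(2)] *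
      show ?thesis by (blast intro: tranclp.trancl_into_trancl)
    qed blast
  qed
qed

text \<open>If neither the run nor its time reversal carries over as a whole, both lead onto
  \<open>C\<close> in \<open>H\<close>, and circling there joins the two pieces.\<close>

lemma can_reach_transfer:
  assumes reach: "can_reach G k ini fin" and k: "2 \<le> k"
    and ini: "set ini \<inter> X = {}" and fin: "set fin \<inter> X = {}"
    and verts: "verts G = verts H"
    and out: "\<And>e. e \<in> edges G \<Longrightarrow> e \<inter> X = {} \<Longrightarrow> e \<in> edges H"
    and touch: "\<And>v x. v \<notin> X \<Longrightarrow> x \<in> X \<Longrightarrow> {x, v} \<in> edges G \<Longrightarrow> \<exists>q\<in>set C. {q, v} \<in> edges H"
    and C: "set C \<subseteq> X" "closed_path H C" "k \<le> length C"
  shows "can_reach H k ini fin"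
proof -
  have k1: "1 \<le> k" using k by simp
  have CH: "set C \<subseteq> verts H" using C by (auto simp: closed_path_def is_path_def)
  have hit: "(transition H k)\<^sup>+\<^sup>+ a b \<and> set b \<inter> X = {} \<or>
    (\<exists>q ys. (transition H k)\<^sup>+\<^sup>+ a (q # ys) \<and> is_conf H k (q # ys) \<and> q \<in> set C \<and> set ys \<inter> X = {})"
    if "(transition G k)\<^sup>+\<^sup>+ a b" "set a \<inter> X = {}" for a b
    by (rule tranclp_avoid_or_hit[OF that(1) k that(2) verts _ _ C(1) CH]) (use out touch in blast)+
  have fwd: "(transition G k)\<^sup>+\<^sup>+ ini fin" using reach by (simp add: can_reach_def)
  have bwd: "(transition G k)\<^sup>+\<^sup>+ (rev fin) (rev ini)" using transition_tranclp_rev[OF fwd k1] .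
  have rfin: "set (rev fin) \<inter> X = {}" using fin by simp
  show ?thesis
  proof (cases "(transition H k)\<^sup>+\<^sup>+ ini fin \<or> (transition H k)\<^sup>+\<^sup>+ (rev fin) (rev ini)")
    case True
    then show ?thesis
      using transition_tranclp_rev[OF _ k1, of H "rev fin" "rev ini"] by (auto simp: can_reach_def)
  next
    case False
    obtain q ys where q: "(transition H k)\<^sup>+\<^sup>+ ini (q # ys)" "is_conf H k (q # ys)" "q \<in> set C" "set ys \<inter> X = {}"
      using hit[OF fwd ini] False by blast
    obtain q' ys' where q': "(transition H k)\<^sup>+\<^sup>+ (rev fin) (q' # ys')" "is_conf H k (q' # ys')"
      "q' \<in> set C" "set ys' \<inter> X = {}"
      using hit[OF bwd rfin] False by blast
    obtain m where m: "(transition H k)\<^sup>*\<^sup>* (q # ys) (take k (rotate m C))"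
      using enter_closed_path[OF C(2,3) q(2,3)] q(4) C(1) by auto
    \<comment> \<open>The backward snake is wound along \<open>rev C\<close>, so that after undoing
      the time reversal it travels around \<open>C\<close> in the same direction as the forward
      one.\<close>
    obtain m' where m': "(transition H k)\<^sup>*\<^sup>* (q' # ys') (take k (rotate m' (rev C)))"
      using enter_closed_path[OF closed_path_rev[OF C(2)] _ q'(2)] q'(3,4) C(1,3) by auto
    have out_fin: "(transition H k)\<^sup>*\<^sup>* (rev (take k (rotate m' (rev C)))) fin"
      using transition_rtranclp_rev[OF rtranclp_trans[OF tranclp_into_rtranclp[OF q'(1)] m'] k1] by simp
    let ?D = "rev (rotate m' (rev C))"
    \<comment> \<open>Reversal turns the first \<open>k\<close> vertices into the last
      \<open>k\<close> of \<open>?D\<close>, and rotating by \<open>length C - k\<close> brings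
      these to the front.\<close>
    have D: "rev (take k (rotate m' (rev C))) = take k (rotate (length C - k) ?D)"
    proof -
      have "rotate (length (take (length C - k) ?D)) (take (length C - k) ?D @ drop (length C - k) ?D)
          = drop (length C - k) ?D @ take (length C - k) ?D"
        by (rule rotate_append)
      then have "rotate (length C - k) ?D = drop (length C - k) ?D @ take (length C - k) ?D"
        by simp
      then show ?thesis using C(3) by (simp add: rev_take)
    qed
    obtain j where j: "?D = rotate j C" by (metis rotate_rev rev_rev_ident)
    have "(transition H k)\<^sup>*\<^sup>* (take k (rotate m C)) (take k (rotate (length C - k) ?D))"
      unfolding j rotate_rotate by (rule rtranclp_rotate_rotate[OF C(2,3) k1])
    then have "(transition H k)\<^sup>*\<^sup>* (q # ys) fin"
      using m out_fin D by (metis rtranclp_trans)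
    then show ?thesis using q(1) by (simp add: can_reach_def)
  qed
qed

text \<open>Without a body there is no adjacency or collision to respect, so a single move joins any
  two configurations, even equal ones.\<close>

lemma can_reach_trivial:
  assumes "is_conf G k ini" "is_conf G k fin" "k \<le> 1"
  shows "can_reach G k ini fin"
proof -
  have "transition G k ini fin" using assms by (auto simp: transition_def)
  then show ?thesis by (auto simp: can_reach_def)
qed

section \<open>Treewidth and depth-first search\<close>

definition add_leaf :: "'a ugraph \<Rightarrow> 'a \<Rightarrow> 'a \<Rightarrow> 'a ugraph" where
  "add_leaf T t x = \<lparr>verts = insert x (verts T), edges = insert {x, t} (edges T)\<rparr>"

lemma connected_graph_add_leaf:
  assumes "connected_graph T" "t \<in> verts T" "x \<notin> verts T"
  shows "connected_graph (add_leaf T t x)"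
proof -
  let ?T = "add_leaf T t x"
  let ?conn = "\<lambda>u v. \<exists>p. is_path ?T p \<and> p \<noteq> [] \<and> hd p = u \<and> last p = v"
  have lift: "is_path ?T p" if "is_path T p" for p
    using that by (auto simp: is_path_def add_leaf_def elim: successively_mono)
  have old: "\<exists>p. is_path ?T p \<and> set p \<subseteq> verts T \<and> p \<noteq> [] \<and> hd p = u \<and> last p = v"
    if "u \<in> verts T" "v \<in> verts T" for u v
    using assms(1) that lift unfolding connected_graph_def is_path_def by meson
  have new: "?conn x v" if v: "v \<in> verts T" for v
  proof -
    obtain p where p: "is_path ?T p" "set p \<subseteq> verts T" "p \<noteq> []" "hd p = t" "last p = v"
      using old[OF assms(2) v] by blast
    then have "is_path ?T (x # p)" using assms by (auto simp: is_path_Cons add_leaf_def)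
    then show ?thesis using p by (metis last_ConsR list.distinct(1) list.sel(1))
  qed
  have sym: "?conn v u" if "?conn u v" for u v
    using that by (metis hd_rev is_path_rev last_rev rev_is_Nil_conv)
  have "?conn x x" by (rule exI[of _ "[x]"]) (simp add: is_path_def add_leaf_def)
  then show ?thesis
    unfolding connected_graph_def using old new sym by (auto simp: add_leaf_def)
qed

lemma is_cycle_rotate1: "is_cycle G p \<Longrightarrow> is_cycle G (rotate1 p)"
  using closed_path_rotate1[of G p] by (cases "p = []") (auto simp: is_cycle_def closed_path_def)

lemma is_cycle_rotate: "is_cycle G p \<Longrightarrow> is_cycle G (rotate m p)"
  by (induction m) (simp_all add: is_cycle_rotate1)

text \<open>On a cycle through the leaf, both cyclic neighbours of \<open>x\<close> would be
  \<open>t\<close>, although a cycle has at least three distinct vertices. A cycle that avoids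
  \<open>x\<close> already lies in \<open>T\<close>.\<close>

lemma is_tree_add_leaf:
  assumes "is_tree T" "t \<in> verts T" "x \<notin> verts T"
  shows "is_tree (add_leaf T t x)"
  unfolding is_tree_def
proof (intro conjI notI)
  have T: "finite_graph T" "connected_graph T" "\<nexists>p. is_cycle T p" using assms by (auto simp: is_tree_def)
  show "finite_graph (add_leaf T t x)"
    using T(1) assms(2,3) by (auto simp: finite_graph_def add_leaf_def card_insert_if)
  show "connected_graph (add_leaf T t x)" using T(2) assms by (intro connected_graph_add_leaf)
  have x: "x \<notin> e" if "e \<in> edges T" for e using T(1) assms(3) that by (auto simp: finite_graph_def)
  assume "\<exists>p. is_cycle (add_leaf T t x) p"
  then obtain p where p: "is_cycle (add_leaf T t x) p" ..
  show False
  proof (cases "x \<in> set p")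
    case False
    then have "is_path T p" "{last p, hd p} \<in> edges T" "length p \<ge> 3"
      using p unfolding is_cycle_def is_path_def
      by (auto simp: add_leaf_def doubleton_eq_iff successively_conv_nth)
        (metis hd_in_set last_in_set list.size(3) not_numeral_le_zero)+
    then show False using T(3) by (auto simp: is_cycle_def)
  next
    case True
    then obtain as bs where "p = as @ x # bs" by (auto simp: in_set_conv_decomp)
    \<comment> \<open>Read from \<open>x\<close>, the cycle has the two neighbours of
      \<open>x\<close> as first and last of the remaining vertices.\<close>
    then have "rotate (length as) p = x # bs @ as" using rotate_append[of as "x # bs"] by simp
    then have c: "is_cycle (add_leaf T t x) (x # bs @ as)" using is_cycle_rotate[OF p, of "length as"] by simp
    then obtain y z r where yz: "bs @ as = y # z # r"
      by (cases "bs @ as"; cases "tl (bs @ as)") (auto simp: is_cycle_def)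
    have "y = t" "last (z # r) = t"
      using c yz x unfolding is_cycle_def
      by (auto simp: is_path_Cons add_leaf_def doubleton_eq_iff)
    moreover have "y \<notin> set (z # r)" using c yz by (auto simp: is_cycle_def is_path_Cons)
    ultimately show False using last_in_set by blast
  qed
qed

lemma connected_graph_single: "connected_graph \<lparr>verts = {x}, edges = E\<rparr>"
proof -
  have "is_path \<lparr>verts = {x}, edges = E\<rparr> [x]" by (simp add: is_path_def)
  then show ?thesis unfolding connected_graph_def
    by (auto intro!: exI[of _ "[x]"])
qed

text \<open>For \<open>X\<close> the set of nodes whose bags contain a given vertex: under a new
  leaf this set stays the same, gains the leaf next to \<open>t\<close>, or consists of the leaf
  alone.\<close>

lemma induced_add_leaf:
  assumes "finite_graph T" "t \<in> verts T" "x \<notin> verts T" "X \<subseteq> verts T"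
  shows "induced (add_leaf T t x) X = induced T X"
    and "t \<in> X \<Longrightarrow> induced (add_leaf T t x) (insert x X) = add_leaf (induced T X) t x"
    and "induced (add_leaf T t x) {x} = \<lparr>verts = {x}, edges = {}\<rparr>"
proof -
  have *: "e \<subseteq> verts T \<and> e \<noteq> {}" if "e \<in> edges T" for e
    using assms(1) that by (auto simp: finite_graph_def)
  show "induced (add_leaf T t x) X = induced T X"
    "t \<in> X \<Longrightarrow> induced (add_leaf T t x) (insert x X) = add_leaf (induced T X) t x"
    "induced (add_leaf T t x) {x} = \<lparr>verts = {x}, edges = {}\<rparr>"
    using * assms(2-4) by (auto simp: induced_def add_leaf_def)
qed

text \<open>The new vertex \<open>v\<close> occurs only in the new bag. A vertex of \<open>S\<close>
  is also in the adjacent bag of \<open>t\<close>, so its nodes stay connected, and by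
  \<open>nb\<close> the new bag covers all new edges.\<close>

lemma tree_decomposition_add_leaf:
  assumes dec: "tree_decomposition (induced G X) T bag"
    and t: "t \<in> verts T" and x: "x \<notin> verts T"
    and v: "v \<in> verts G" "v \<notin> X" and S: "S \<subseteq> bag t"
    and nb: "\<And>e. e \<in> edges G \<Longrightarrow> v \<in> e \<Longrightarrow> e \<subseteq> insert v X \<Longrightarrow> e \<subseteq> insert v S"
  shows "tree_decomposition (induced G (insert v X)) (add_leaf T t x) (bag(x := insert v S))"
  unfolding tree_decomposition_def
proof (intro conjI ballI)
  let ?bag = "bag(x := insert v S)"
  have T: "is_tree T" and sub: "\<And>t. t \<in> verts T \<Longrightarrow> bag t \<subseteq> verts G \<inter> X"
    and cover: "\<And>e. e \<in> edges G \<Longrightarrow> e \<subseteq> X \<Longrightarrow> \<exists>t\<in>verts T. e \<subseteq> bag t"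
    and conn: "\<And>u. u \<in> verts G \<inter> X \<Longrightarrow> connected_graph (induced T {t \<in> verts T. u \<in> bag t})"
    using dec by (auto simp: tree_decomposition_def induced_def)
  have fT: "finite_graph T" using T by (simp add: is_tree_def)
  show "is_tree (add_leaf T t x)" using T t x by (rule is_tree_add_leaf)
  show "?bag s \<subseteq> verts (induced G (insert v X))" if "s \<in> verts (add_leaf T t x)" for s
    using that sub[of s] sub[OF t] S v by (auto simp: add_leaf_def induced_def)
  show "\<exists>s\<in>verts (add_leaf T t x). e \<subseteq> ?bag s" if "e \<in> edges (induced G (insert v X))" for e
  proof (cases "v \<in> e")
    case True
    then show ?thesis using that nb[of e] by (auto simp: add_leaf_def induced_def)
  next
    case False
    then have "e \<in> edges G" "e \<subseteq> X" using that by (auto simp: induced_def)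
    then obtain s where "s \<in> verts T" "e \<subseteq> bag s" using cover by blast
    then show ?thesis using x by (intro bexI[of _ s]) (auto simp: add_leaf_def)
  qed
  show "connected_graph (induced (add_leaf T t x) {s \<in> verts (add_leaf T t x). u \<in> ?bag s})"
    if "u \<in> verts (induced G (insert v X))" for u
  proof -
    let ?U = "{s \<in> verts T. u \<in> bag s}"
    have vb: "v \<notin> bag s" if "s \<in> verts T" for s using sub[OF that] v by auto
    have U: "{s \<in> verts (add_leaf T t x). u \<in> ?bag s} = (if u \<in> insert v S then insert x ?U else ?U)"
      using x by (auto simp: add_leaf_def)
    consider "u = v" | "u \<noteq> v" "u \<in> S" | "u \<noteq> v" "u \<notin> S" by blast
    then show ?thesis
    proof cases
      case 1
      then have empty: "?U = {}" using vb by auto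
      show ?thesis unfolding U empty using 1 induced_add_leaf(3)[OF fT t x, of "{}"] connected_graph_single by simp
    next
      case 2
      then have "connected_graph (induced T ?U)" using conn that by (auto simp: induced_def)
      then have "connected_graph (add_leaf (induced T ?U) t x)"
        using 2 S t x by (intro connected_graph_add_leaf) (auto simp: induced_def)
      then show ?thesis unfolding U using 2 induced_add_leaf(2)[OF fT t x, of ?U] S t by auto
    next
      case 3
      then show ?thesis unfolding U using conn that induced_add_leaf(1)[OF fT t x, of ?U]
        by (auto simp: induced_def)
    qed
  qed
qed

lemma treewidth_le:
  assumes "tree_decomposition G (T :: nat ugraph) bag" "\<And>t. t \<in> verts T \<Longrightarrow> card (bag t) \<le> Suc w"
  shows "treewidth G \<le> w"
proof -
  have T: "finite (verts T)" "verts T \<noteq> {}"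
    using assms(1) by (auto simp: tree_decomposition_def is_tree_def finite_graph_def connected_graph_def)
  have "treewidth G \<le> width T bag" unfolding treewidth_def by (rule Least_le) (use assms in blast)
  also have "Max ((\<lambda>t. card (bag t)) ` verts T) \<le> Suc w" using T assms(2) by (intro Max.boundedI) auto
  then have "width T bag \<le> w" by (simp add: width_def)
  finally show ?thesis .
qed

text \<open>\<open>D\<close> consists of the visited vertices outside \<open>Z\<close>, and the stack \<open>st\<close> starts with its
  topmost vertex. Only the decomposition matters here, so there is no condition on when a vertex
  may be popped.\<close>

inductive local_dfs :: "'a ugraph \<Rightarrow> 'a set \<Rightarrow> nat \<Rightarrow> 'a set \<Rightarrow> 'a list \<Rightarrow> bool" for G Z l where
  start: "local_dfs G Z l {} []"
| push: "local_dfs G Z l D st \<Longrightarrow> v \<in> verts G - D - Z \<Longrightarrow>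
    (\<And>u. u \<in> D \<Longrightarrow> {v, u} \<in> edges G \<Longrightarrow> u \<in> set (take l st)) \<Longrightarrow>
    local_dfs G Z l (insert v D) (v # st)"
| pop: "local_dfs G Z l D (v # st) \<Longrightarrow> local_dfs G Z l D st"

text \<open>The last clause provides a bag around \<open>Z\<close> and the \<open>l\<close> topmost
  vertices of every stack that can arise by popping. So a new vertex can always be attached at the
  bag for the current stack, and a pop leaves the decomposition alone.\<close>

lemma local_dfs_decomposition:
  assumes "local_dfs G Z l D st" "finite_graph G" "Z \<subseteq> verts G"
  shows "\<exists>(T :: nat ugraph) bag. tree_decomposition (induced G (D \<union> Z)) T bag \<and>
    (\<forall>t\<in>verts T. card (bag t) \<le> Suc l + card Z) \<and>
    (\<forall>i. \<exists>t\<in>verts T. set (take l (drop i st)) \<union> Z \<subseteq> bag t)"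
  using assms(1)
proof induction
  case start
  let ?T = "\<lparr>verts = {0 :: nat}, edges = {}\<rparr>"
  have "is_tree ?T"
    unfolding is_tree_def using connected_graph_single[of 0 "{}"]
    by (auto simp: finite_graph_def is_cycle_def)
  moreover have "connected_graph (induced ?T {t \<in> verts ?T. v \<in> Z})" if "v \<in> Z" for v
    using connected_graph_single[of 0 "{}"] that by (simp add: induced_def)
  ultimately have "tree_decomposition (induced G Z) ?T (\<lambda>_. Z)"
    using assms(3) by (auto simp: tree_decomposition_def induced_def)
  then show ?case by (intro exI[of _ ?T] exI[of _ "\<lambda>_. Z"]) auto
next
  case (push D st v)
  then obtain T :: "nat ugraph" and bag where
    dec: "tree_decomposition (induced G (D \<union> Z)) T bag"
    and small: "\<And>t. t \<in> verts T \<Longrightarrow> card (bag t) \<le> Suc l + card Z"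
    and windows: "\<And>i. \<exists>t\<in>verts T. set (take l (drop i st)) \<union> Z \<subseteq> bag t"
    by blast
  obtain t where t: "t \<in> verts T" "set (take l st) \<union> Z \<subseteq> bag t" using windows[of 0] by auto
  have "finite (verts T)" using dec by (auto simp: tree_decomposition_def is_tree_def finite_graph_def)
  then obtain x where x: "x \<notin> verts T" using infinite_UNIV_nat ex_new_if_finite by blast
  let ?S = "set (take l st) \<union> Z"
  have "e \<subseteq> insert v ?S" if "e \<in> edges G" "v \<in> e" "e \<subseteq> insert v (D \<union> Z)" for e
  proof -
    have "card e = 2" using assms(2) that by (auto simp: finite_graph_def)
    then obtain u where "e = {v, u}" "u \<noteq> v" using \<open>v \<in> e\<close> by (auto simp: card_2_iff insert_commute)
    then show ?thesis using push.hyps(3)[of u] \<open>e \<in> edges G\<close> \<open>e \<subseteq> insert v (D \<union> Z)\<close> by auto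
  qed
  then have dec': "tree_decomposition (induced G (insert v (D \<union> Z))) (add_leaf T t x) (bag(x := insert v ?S))"
    using push.hyps(2) t x by (intro tree_decomposition_add_leaf[OF dec]) auto
  have fZ: "finite Z" using assms(2,3) by (auto simp: finite_graph_def intro: finite_subset)
  have "card (insert v ?S) \<le> Suc (card ?S)" by (rule card_insert_le_m1) auto
  also have "card ?S \<le> card (set (take l st)) + card Z" by (rule card_Un_le)
  also have "card (set (take l st)) \<le> l" using card_length[of "take l st"] by simp
  finally have new: "card (insert v ?S) \<le> Suc l + card Z" by simp
  have small': "\<forall>s\<in>verts (add_leaf T t x). card ((bag(x := insert v ?S)) s) \<le> Suc l + card Z"
    using small new by (auto simp: add_leaf_def)
  have "\<exists>s\<in>verts (add_leaf T t x). set (take l (drop i (v # st))) \<union> Z \<subseteq> (bag(x := insert v ?S)) s" for i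
  proof (cases i)
    case 0
    have "set (take l (v # st)) \<subseteq> insert v (set (take l st))"
      using set_take_subset_set_take[of "l - 1" l st] by (cases l) auto
    then show ?thesis using 0 by (auto simp: add_leaf_def)
  next
    case (Suc j)
    obtain s where s: "s \<in> verts T" "set (take l (drop j st)) \<union> Z \<subseteq> bag s" using windows by blast
    then have "s \<noteq> x" using x by auto
    then show ?thesis using s Suc by (intro bexI[of _ s]) (auto simp: add_leaf_def)
  qed
  then have windows': "\<forall>i. \<exists>s\<in>verts (add_leaf T t x). set (take l (drop i (v # st))) \<union> Z \<subseteq> (bag(x := insert v ?S)) s"
    by blast
  show ?case
    unfolding Un_insert_left using dec' small' windows'
    by (intro exI[of _ "add_leaf T t x"] exI[of _ "bag(x := insert v ?S)"] conjI)
next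
  case (pop D v st)
  \<comment> \<open>Dropping \<open>i\<close> vertices from \<open>st\<close> is dropping
    \<open>i + 1\<close> from \<open>v # st\<close>, so the windows are among the old ones.\<close>
  then show ?case by (metis drop_Suc_Cons)
qed

lemma treewidth_local_dfs:
  assumes "local_dfs G Z l D st" "finite_graph G" "Z \<subseteq> verts G" "verts G = D \<union> Z"
  shows "treewidth G \<le> l + card Z"
proof -
  have "e \<subseteq> verts G" if "e \<in> edges G" for e
    using assms(2) that by (auto simp: finite_graph_def)
  then have "induced G (verts G) = G" by (auto simp: induced_def intro!: ugraph.equality)
  then show ?thesis
    using local_dfs_decomposition[OF assms(1-3)] assms(4) treewidth_le by (metis add_Suc)
qed

section \<open>Contraction of long cycles\<close>

text \<open>The program addresses vertices by their positions in \<open>vs\<close> and keeps a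
  matrix over positions; this reads such a matrix as a graph on the vertices themselves.\<close>

definition index_graph :: "'a list \<Rightarrow> (nat \<Rightarrow> nat \<Rightarrow> bool) \<Rightarrow> 'a ugraph" where
  "index_graph vs A = \<lparr>verts = set vs,
     edges = {{vs ! i, vs ! j} |i j. i < length vs \<and> j < length vs \<and> A i j}\<rparr>"

definition simple_rel :: "nat \<Rightarrow> (nat \<Rightarrow> nat \<Rightarrow> bool) \<Rightarrow> bool" where
  "simple_rel n A \<longleftrightarrow> (\<forall>i<n. \<forall>j<n. A i j \<longrightarrow> A j i) \<and> (\<forall>i<n. \<not> A i i)"

lemma simple_rel_sym: "simple_rel n A \<Longrightarrow> i < n \<Longrightarrow> j < n \<Longrightarrow> A i j \<Longrightarrow> A j i"
  unfolding simple_rel_def by blast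

lemma simple_rel_irrefl: "simple_rel n A \<Longrightarrow> i < n \<Longrightarrow> \<not> A i i"
  unfolding simple_rel_def by blast

lemma verts_index_graph [simp]: "verts (index_graph vs A) = set vs"
  by (simp add: index_graph_def)

lemma finite_graph_index_graph:
  assumes "simple_rel (length vs) A" "distinct vs"
  shows "finite_graph (index_graph vs A)"
proof -
  have "card {vs ! i, vs ! j} = 2" if "i < length vs" "j < length vs" "A i j" for i j
  proof -
    have "i \<noteq> j" using simple_rel_irrefl[OF assms(1)] that by auto
    then show ?thesis using assms(2) that by (simp add: nth_eq_iff_index_eq)
  qed
  then show ?thesis by (auto simp: finite_graph_def index_graph_def)
qed

lemma edge_index_graph:
  assumes "simple_rel (length vs) A" "distinct vs" "i < length vs" "j < length vs"
  shows "{vs ! i, vs ! j} \<in> edges (index_graph vs A) \<longleftrightarrow> A i j"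
proof
  assume "{vs ! i, vs ! j} \<in> edges (index_graph vs A)"
  then obtain a b where "{vs ! i, vs ! j} = {vs ! a, vs ! b}" "a < length vs" "b < length vs" "A a b"
    by (auto simp: index_graph_def)
  moreover from this have "A b a" using simple_rel_sym[OF assms(1)] by blast
  ultimately show "A i j"
    using assms(2-4) by (auto simp: doubleton_eq_iff nth_eq_iff_index_eq)
qed (use assms(3,4) in \<open>auto simp: index_graph_def\<close>)

lemma is_path_index_graph:
  assumes "simple_rel (length vs) A" "distinct vs" "set p \<subseteq> {..<length vs}"
  shows "is_path (index_graph vs A) (map ((!) vs) p) \<longleftrightarrow> distinct p \<and> successively A p"
  using assms(3)
proof (induction p)
  case (Cons a p)
  have "vs ! a \<in> (!) vs ` set p \<longleftrightarrow> a \<in> set p"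
    using Cons.prems assms(2) by (auto simp: nth_eq_iff_index_eq subset_iff)
  moreover have "{vs ! a, vs ! hd p} \<in> edges (index_graph vs A) \<longleftrightarrow> A a (hd p)" if "p \<noteq> []"
    using that Cons.prems assms by (intro edge_index_graph) (auto simp: subset_iff)
  ultimately show ?case
    using Cons by (auto simp: is_path_Cons successively_Cons hd_map)
qed (simp add: is_path_Nil)

section \<open>Contraction of an edge on a long cycle\<close>

text \<open>\<open>u\<close> inherits the edges of \<open>w\<close>. The inequalities with
  \<open>u\<close> keep the contracted edge from turning into a loop at \<open>u\<close>.\<close>

definition contract :: "(nat \<Rightarrow> nat \<Rightarrow> bool) \<Rightarrow> nat \<Rightarrow> nat \<Rightarrow> nat \<Rightarrow> nat \<Rightarrow> bool" where
  "contract A u w a b \<longleftrightarrow> a \<noteq> w \<and> b \<noteq> w \<and>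
     (A a b \<or> a = u \<and> b \<noteq> u \<and> A w b \<or> b = u \<and> a \<noteq> u \<and> A w a)"

lemma simple_rel_contract: "simple_rel n A \<Longrightarrow> simple_rel n (contract A u w)"
  unfolding simple_rel_def contract_def by blast

definition non_isolated :: "nat \<Rightarrow> (nat \<Rightarrow> nat \<Rightarrow> bool) \<Rightarrow> nat set" where
  "non_isolated n A = {a. a < n \<and> (\<exists>b<n. A a b)}"

text \<open>\<open>w\<close> becomes isolated and no vertex ceases to be so: \<open>u\<close> was
  joined to \<open>w\<close> before, and so was any vertex that gains \<open>u\<close> as a
  neighbour.\<close>

lemma card_non_isolated_contract:
  assumes "simple_rel n A" "A w u" "u < n" "w < n"
  shows "card (non_isolated n (contract A u w)) < card (non_isolated n A)"
proof (rule psubset_card_mono)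
  show "finite (non_isolated n A)" by (simp add: non_isolated_def)
  have "non_isolated n (contract A u w) \<subseteq> non_isolated n A"
    using assms(2-4) simple_rel_sym[OF assms(1)] unfolding non_isolated_def contract_def by blast
  moreover have "w \<in> non_isolated n A" "w \<notin> non_isolated n (contract A u w)"
    using assms by (auto simp: non_isolated_def contract_def)
  ultimately show "non_isolated n (contract A u w) \<subset> non_isolated n A" by auto
qed

text \<open>The cycle runs from \<open>w\<close> through the stack from its top \<open>u\<close>
  down to \<open>st ! i\<close> and back to \<open>w\<close>. It has \<open>i + 2\<close> vertices,
  so more than \<open>k\<close> are left after contraction, and the transfer lemma applies in both
  directions with the same \<open>X\<close>.\<close>

lemma can_reach_contract:
  assumes A: "simple_rel (length vs) A" and vs: "distinct vs" and k: "2 \<le> k"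
    and st: "distinct (w # st)" "successively A st" "set (w # st) \<subseteq> {..<length vs}"
    and u: "st \<noteq> []" "hd st = u" "A w u"
    and i: "k \<le> i" "i < length st" "A w (st ! i)"
    and ends: "set ini \<inter> (!) vs ` set (w # st) = {}" "set fin \<inter> (!) vs ` set (w # st) = {}"
  shows "can_reach (index_graph vs (contract A u w)) k ini fin \<longleftrightarrow> can_reach (index_graph vs A) k ini fin"
proof -
  let ?G = "index_graph vs A" and ?H = "index_graph vs (contract A u w)"
  let ?B = "contract A u w"
  have B: "simple_rel (length vs) ?B" using A by (rule simple_rel_contract)
  define C where "C = take (Suc i) st"
  define X where "X = (!) vs ` set (w # C)"
  have sub: "set C \<subseteq> set st" by (simp add: C_def set_take_subset)
  have lenC: "length C = Suc i" using i by (simp add: C_def)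
  then have C0: "C \<noteq> []" by auto
  have hdC: "hd C = u" using u by (simp add: C_def hd_take)
  have lastC: "last C = st ! i" using i lenC C0 by (simp add: last_conv_nth) (simp add: C_def)
  have dC: "distinct (w # C)" using st(1) sub by (auto simp: C_def)
  have sC: "successively A C" using st(2) by (metis C_def append_take_drop_id successively_append_iff)
  have wC: "set (w # C) \<subseteq> {..<length vs}" using st(3) sub by auto
  have ends': "set ini \<inter> X = {}" "set fin \<inter> X = {}" using ends sub by (auto simp: X_def)
  have uC: "u \<in> set C" using hdC C0 hd_in_set by blast
  have lC: "last C \<in> set C" using C0 by simp
  have un: "u < length vs" "w < length vs" "last C < length vs" using uC lC wC by auto
  \<comment> \<open>\<open>2 \<le> k \<le> i\<close> puts \<open>st ! i\<close> strictly below the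
    top of the stack, so the edge that closes the contracted cycle is no loop.\<close>
  have ul: "u \<noteq> last C"
  proof -
    have "st ! 0 \<noteq> st ! i" using st(1) i k u(1) nth_eq_iff_index_eq[of st 0 i] by auto
    then show ?thesis using u lastC by (simp add: hd_conv_nth)
  qed
  have X: "vs ! a \<in> X \<longleftrightarrow> a \<in> set (w # C)" if "a < length vs" for a
    using that wC vs by (auto simp: X_def nth_eq_iff_index_eq subset_iff)
  have edge: "\<exists>a b. a < length vs \<and> b < length vs \<and> x = vs ! a \<and> y = vs ! b \<and> A a b"
    if "simple_rel (length vs) A" "{x, y} \<in> edges (index_graph vs A)" for A x y
  proof -
    note A = that(1)
    obtain a b where "{x, y} = {vs ! a, vs ! b}" "a < length vs" "b < length vs" "A a b"
      using \<open>{x, y} \<in> _\<close> by (auto simp: index_graph_def)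
    moreover from this have "A b a" using simple_rel_sym[OF A] by blast
    ultimately show ?thesis unfolding doubleton_eq_iff by blast
  qed
  have sCB: "successively ?B C"
    by (rule successively_mono[OF sC]) (use dC in \<open>auto simp: contract_def\<close>)
  have closedG: "closed_path ?G (map ((!) vs) (w # C))"
  proof -
    have "is_path ?G (map ((!) vs) (w # C))"
      using is_path_index_graph[OF A vs wC] dC sC u hdC by (simp add: successively_Cons)
    moreover have "{vs ! last C, vs ! w} \<in> edges ?G"
      using edge_index_graph[OF A vs, of "last C" w] un i(3) lastC simple_rel_sym[OF A, of w "last C"] by auto
    ultimately show ?thesis using C0 by (simp add: closed_path_def last_map)
  qed
  have closedH: "closed_path ?H (map ((!) vs) C)"
  proof -
    have "is_path ?H (map ((!) vs) C)"
      using is_path_index_graph[OF B vs, of C] dC sCB wC by simp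
    moreover have "?B (last C) u"
      using ul i(3) lastC dC uC lC by (auto simp: contract_def)
    then have "{vs ! last C, vs ! u} \<in> edges ?H"
      using edge_index_graph[OF B vs, of "last C" u] un by simp
    ultimately show ?thesis using C0 hdC by (simp add: closed_path_def last_map hd_map)
  qed
  have "can_reach ?H k ini fin" if "can_reach ?G k ini fin"
    using that k ends'
  proof (rule can_reach_transfer[where C = "map ((!) vs) C"])
    show "e \<in> edges ?H" if "e \<in> edges ?G" "e \<inter> X = {}" for e
    proof -
      obtain a b where e: "e = {vs ! a, vs ! b}" "a < length vs" "b < length vs" "A a b"
        using \<open>e \<in> edges ?G\<close> by (auto simp: index_graph_def)
      then have "?B a b" using X that(2) by (auto simp: contract_def)
      then show ?thesis using e edge_index_graph[OF B vs, of a b] by simp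
    qed
    show "\<exists>q\<in>set (map ((!) vs) C). {q, v} \<in> edges ?H" if vx: "v \<notin> X" "x \<in> X" "{x, v} \<in> edges ?G" for v x
    proof -
      obtain a b where ab: "x = vs ! a" "v = vs ! b" "a < length vs" "b < length vs" "A a b"
        using edge[OF A vx(3)] by blast
      \<comment> \<open>An entry through \<open>w\<close> is redirected to \<open>u\<close>, which
        has inherited the edges of \<open>w\<close>.\<close>
      let ?a = "if a = w then u else a"
      have "?B ?a b" "?a \<in> set C"
        using ab vx(1,2) X uC dC by (auto simp: contract_def)
      then show ?thesis using ab edge_index_graph[OF B vs, of ?a b] un
        by (intro bexI[of _ "vs ! ?a"]) auto
    qed
    show "set (map ((!) vs) C) \<subseteq> X" by (auto simp: X_def)
  qed (use closedH lenC i in auto)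
  moreover have "can_reach ?G k ini fin" if "can_reach ?H k ini fin"
    using that k ends'
  proof (rule can_reach_transfer[where C = "map ((!) vs) (w # C)"])
    show "e \<in> edges ?G" if "e \<in> edges ?H" "e \<inter> X = {}" for e
    proof -
      obtain a b where e: "e = {vs ! a, vs ! b}" "a < length vs" "b < length vs" "?B a b"
        using \<open>e \<in> edges ?H\<close> by (auto simp: index_graph_def)
      then have "A a b" using X that(2) uC by (auto simp: contract_def)
      then show ?thesis using e edge_index_graph[OF A vs, of a b] by simp
    qed
    show "\<exists>q\<in>set (map ((!) vs) (w # C)). {q, v} \<in> edges ?G" if vx: "v \<notin> X" "x \<in> X" "{x, v} \<in> edges ?H" for v x
    proof -
      obtain a b where ab: "x = vs ! a" "v = vs ! b" "a < length vs" "b < length vs" "?B a b"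
        using edge[OF B vx(3)] by blast
      then have "b \<noteq> u" using X[of b] vx(1) uC by auto
      \<comment> \<open>An edge of \<open>?H\<close> that leaves \<open>X\<close> is either old or
        inherited from \<open>w\<close>, and \<open>w\<close> is on the cycle in
        \<open>?G\<close>.\<close>
      then have "A a b \<or> A w b" using ab by (auto simp: contract_def)
      moreover have "a \<in> set (w # C)" using X[of a] ab vx(2) by auto
      ultimately obtain q where "q \<in> set (w # C)" "A q b" by auto
      moreover have "q < length vs" using \<open>q \<in> set (w # C)\<close> wC by auto
      ultimately show ?thesis using ab edge_index_graph[OF A vs, of q b]
        by (intro bexI[of _ "vs ! q"]) auto
    qed
    show "set (map ((!) vs) (w # C)) \<subseteq> X" by (auto simp: X_def)
  qed (use closedG lenC i in auto)
  ultimately show ?thesis by blast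
qed

section \<open>The invariant of the search\<close>

text \<open>\<open>Z\<close> is meant for the positions of \<open>ini\<close> and
  \<open>fin\<close>, which count as visited from the start so that the search never enters them.
  Popped vertices have no unvisited neighbour.\<close>

definition dfs_inv :: "'a list \<Rightarrow> nat set \<Rightarrow> nat \<Rightarrow> (nat \<Rightarrow> nat \<Rightarrow> bool) \<Rightarrow> nat set \<Rightarrow> nat list \<Rightarrow> bool" where
  "dfs_inv vs Z k A V st \<longleftrightarrow> simple_rel (length vs) A \<and> Z \<subseteq> V \<and> V \<subseteq> {..<length vs} \<and>
     distinct st \<and> set st \<subseteq> V - Z \<and> successively A st \<and>
     (\<forall>a\<in>V - Z - set st. \<forall>b<length vs. A a b \<longrightarrow> b \<in> V) \<and>
     local_dfs (index_graph vs A) ((!) vs ` Z) k ((!) vs ` (V - Z)) (map ((!) vs) st)"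

lemma dfs_invD:
  assumes "dfs_inv vs Z k A V st"
  shows "simple_rel (length vs) A" "Z \<subseteq> V" "V \<subseteq> {..<length vs}"
    "distinct st" "set st \<subseteq> V - Z" "successively A st"
  using assms unfolding dfs_inv_def by blast+

lemma dfs_inv_start:
  assumes "simple_rel (length vs) A" "Z \<subseteq> {..<length vs}"
  shows "dfs_inv vs Z k A Z []"
  using assms local_dfs.start by (auto simp: dfs_inv_def)

lemma dfs_inv_pop:
  assumes "dfs_inv vs Z k A V (v # st)" "\<And>b. b < length vs \<Longrightarrow> A v b \<Longrightarrow> b \<in> V"
  shows "dfs_inv vs Z k A V st"
proof -
  have "\<forall>a\<in>V - Z - set st. \<forall>b<length vs. A a b \<longrightarrow> b \<in> V"
    using assms unfolding dfs_inv_def by (metis DiffI Diff_iff set_ConsD)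
  moreover have "local_dfs (index_graph vs A) ((!) vs ` Z) k ((!) vs ` (V - Z)) (map ((!) vs) st)"
    using assms(1) by (auto simp: dfs_inv_def intro: local_dfs.pop)
  ultimately show ?thesis
    using assms(1) unfolding dfs_inv_def by (auto simp only: successively_Cons successively.simps distinct.simps set_simps insert_subset)
qed

text \<open>If a visited neighbour of \<open>w\<close> outside \<open>Z\<close> had been popped,
  \<open>w\<close> would be visited. So it is on the stack, and \<open>near\<close> places it among
  the \<open>k\<close> topmost vertices, as \<open>local_dfs.push\<close> requires.\<close>

lemma dfs_inv_push:
  assumes inv: "dfs_inv vs Z k A V st" and vs: "distinct vs" and w: "w < length vs" "w \<notin> V"
    and top: "st = [] \<or> A (hd st) w"
    and near: "\<And>i. k \<le> i \<Longrightarrow> i < length st \<Longrightarrow> \<not> A w (st ! i)"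
  shows "dfs_inv vs Z k A (insert w V) (w # st)"
proof -
  let ?f = "(!) vs"
  have A: "simple_rel (length vs) A" and V: "Z \<subseteq> V" "V \<subseteq> {..<length vs}" "set st \<subseteq> V - Z"
    and fin: "\<And>a b. a \<in> V - Z - set st \<Longrightarrow> b < length vs \<Longrightarrow> A a b \<Longrightarrow> b \<in> V"
    and dfs: "local_dfs (index_graph vs A) (?f ` Z) k (?f ` (V - Z)) (map ?f st)"
    using inv by (auto simp: dfs_inv_def)
  have "local_dfs (index_graph vs A) (?f ` Z) k (insert (?f w) (?f ` (V - Z))) (?f w # map ?f st)"
  proof (rule local_dfs.push[OF dfs])
    show "?f w \<in> verts (index_graph vs A) - ?f ` (V - Z) - ?f ` Z"
      using w V vs by (auto simp: nth_eq_iff_index_eq subset_iff)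
    fix x assume x: "x \<in> ?f ` (V - Z)" "{?f w, x} \<in> edges (index_graph vs A)"
    then obtain a where a: "x = ?f a" "a \<in> V" "a \<notin> Z" by auto
    have "A w a" using x a V w edge_index_graph[OF A vs, of w a] by auto
    then have "A a w" using simple_rel_sym[OF A, of w a] a V w by auto
    then have "a \<in> set st" using fin[of a w] a w by auto
    then obtain i where i: "i < length st" "a = st ! i" by (auto simp: in_set_conv_nth)
    then have "i < k" using near[of i] \<open>A w a\<close> by force
    then have "a \<in> set (take k st)" using i by (auto simp: in_set_conv_nth intro!: exI[of _ i])
    then show "x \<in> set (take k (map ?f st))" using a by (simp add: take_map)
  qed
  moreover have "A w (hd st)" if "st \<noteq> []"
    using top that simple_rel_sym[OF A, of "hd st" w] w V hd_in_set[OF that] by blast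
  then have "successively A (w # st)" using inv by (auto simp: dfs_inv_def successively_Cons)
  moreover have "insert w V - Z = insert w (V - Z)" using w V by auto
  moreover have "\<forall>a\<in>insert w V - Z - set (w # st). \<forall>b<length vs. A a b \<longrightarrow> b \<in> insert w V"
    using fin by (metis DiffD1 DiffD2 DiffI insert_iff list.set(2))
  moreover have "distinct (w # st)" "Z \<subseteq> insert w V" "insert w V \<subseteq> {..<length vs}"
    "set (w # st) \<subseteq> insert w V - Z"
    using inv w V by (auto simp: dfs_inv_def)
  ultimately show ?thesis
    using A unfolding dfs_inv_def by simp
qed

lemma treewidth_dfs_inv:
  assumes "dfs_inv vs Z k A V []" "V = {..<length vs}" "distinct vs"
  shows "treewidth (index_graph vs A) \<le> k + card Z"
proof -
  have inv: "simple_rel (length vs) A" "Z \<subseteq> V"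
    "local_dfs (index_graph vs A) ((!) vs ` Z) k ((!) vs ` (V - Z)) []"
    using assms by (auto simp: dfs_inv_def)
  have img: "(!) vs ` {..<length vs} = set vs" by (auto simp: in_set_conv_nth)
  have "treewidth (index_graph vs A) \<le> k + card ((!) vs ` Z)"
    by (rule treewidth_local_dfs[OF inv(3) finite_graph_index_graph[OF inv(1) assms(3)]])
      (use img inv(2) assms(2) in \<open>auto simp flip: image_Un\<close>)
  also have "card ((!) vs ` Z) \<le> card Z"
    using inv(2) assms(2) by (intro card_image_le) (auto intro: finite_subset)
  finally show ?thesis by simp
qed

section \<open>Running times of programs\<close>

definition halts :: "nat \<Rightarrow> program \<Rightarrow> (nat \<Rightarrow> nat) \<Rightarrow> (nat \<Rightarrow> nat) \<Rightarrow> nat \<Rightarrow>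
    ((nat \<Rightarrow> nat) \<Rightarrow> (nat \<Rightarrow> nat) \<Rightarrow> bool) \<Rightarrow> bool" where
  "halts W P R M t Q \<longleftrightarrow> (\<exists>t'\<le>t. \<exists>R' M'. exec W P (R, M) t' (R', M') \<and> Q R' M')"

lemma halts_mono:
  assumes "halts W P R M t Q" "t \<le> t'" "\<And>R M. Q R M \<Longrightarrow> Q' R M"
  shows "halts W P R M t' Q'"
  using assms unfolding halts_def by (meson le_trans)

lemma halts_Seq:
  assumes "halts W P R M t Q" "\<And>R' M'. Q R' M' \<Longrightarrow> halts W P' R' M' t' Q'"
  shows "halts W (Seq P P') R M (t + t') Q'"
  using assms unfolding halts_def by (metis add_mono exec.Seq)

lemma halts_Branch:
  assumes "cond_val R b \<Longrightarrow> halts W P R M t Q" "\<not> cond_val R b \<Longrightarrow> halts W P' R M t Q"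
  shows "halts W (Branch b P P') R M (1 + t) Q"
  using assms unfolding halts_def
  by (metis add_le_mono1 add.commute exec.BranchFalse exec.BranchTrue fst_conv)

text \<open>The number \<open>p\<close> in the invariant drops in every iteration and so bounds the
  iterations left. Each pays one step for the test besides its body; the last \<open>+ 1\<close> is
  the failing test.\<close>

lemma halts_While:
  assumes "I p R M"
    and "\<And>p R M. I p R M \<Longrightarrow> cond_val R b \<Longrightarrow> halts W P R M t (\<lambda>R' M'. \<exists>p'<p. I p' R' M')"
  shows "halts W (While b P) R M (p * (t + 1) + 1) (\<lambda>R' M'. \<exists>p'. I p' R' M' \<and> \<not> cond_val R' b)"
  using assms(1)
proof (induction p arbitrary: R M rule: less_induct)
  case (less p)
  show ?case
  proof (cases "cond_val R b")
    case False
    then show ?thesis unfolding halts_def using less.prems exec.WhileFalse[of "(R, M)" b W P] by fastforce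
  next
    case True
    obtain t1 R1 M1 p1 where 1: "t1 \<le> t" "exec W P (R, M) t1 (R1, M1)" "I p1 R1 M1" "p1 < p"
      using assms(2)[OF less.prems True] by (auto simp: halts_def)
    obtain t2 R2 M2 p2 where 2: "t2 \<le> p1 * (t + 1) + 1" "exec W (While b P) (R1, M1) t2 (R2, M2)"
      "I p2 R2 M2" "\<not> cond_val R2 b"
      using less.IH[OF 1(4) 1(3)] by (auto simp: halts_def)
    have "exec W (While b P) (R, M) (1 + t1 + t2) (R2, M2)"
      using True 1(2) 2(2) by (intro exec.WhileTrue) auto
    moreover have "1 + t1 + t2 \<le> p * (t + 1) + 1"
    proof -
      have "(p1 + 1) * (t + 1) \<le> p * (t + 1)" using 1(4) by (intro mult_right_mono) auto
      then show ?thesis using 1(1) 2(1) by (simp add: algebra_simps)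
    qed
    ultimately show ?thesis unfolding halts_def using 2 by blast
  qed
qed

text \<open>Weakest preconditions of loop-free code, whose time is bounded by \<open>cost\<close>. A
  loop gets the precondition \<open>False\<close>, so \<open>halts_wp\<close> claims nothing about
  loops, whatever their \<open>cost\<close>.\<close>

primrec wp :: "nat \<Rightarrow> program \<Rightarrow> ((nat \<Rightarrow> nat) \<Rightarrow> (nat \<Rightarrow> nat) \<Rightarrow> bool) \<Rightarrow>
    (nat \<Rightarrow> nat) \<Rightarrow> (nat \<Rightarrow> nat) \<Rightarrow> bool" where
  "wp W Skip Q = Q"
| "wp W (Compute r f a b) Q = (\<lambda>R M. arith_val f (operand_val R a) (operand_val R b) < W \<and>
     Q (R(r := arith_val f (operand_val R a) (operand_val R b))) M)"
| "wp W (Load r a) Q = (\<lambda>R M. operand_val R a < W \<and> Q (R(r := M (operand_val R a))) M)"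
| "wp W (Store a b) Q = (\<lambda>R M. operand_val R a < W \<and> operand_val R b < W \<and>
     Q R (M(operand_val R a := operand_val R b)))"
| "wp W (Seq P P') Q = wp W P (wp W P' Q)"
| "wp W (Branch b P P') Q = (\<lambda>R M. if cond_val R b then wp W P Q R M else wp W P' Q R M)"
| "wp W (While b P) Q = (\<lambda>R M. False)"

primrec cost :: "program \<Rightarrow> nat" where
  "cost Skip = 1"
| "cost (Compute r f a b) = 1"
| "cost (Load r a) = 1"
| "cost (Store a b) = 1"
| "cost (Seq P P') = cost P + cost P'"
| "cost (Branch b P P') = 1 + max (cost P) (cost P')"
| "cost (While b P) = 0"

lemma halts_wp: "wp W P Q R M \<Longrightarrow> halts W P R M (cost P) Q"
proof (induction P arbitrary: Q R M)
  case Skip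
  then have "exec W Skip (R, M) 1 (R, M)" by (intro exec.Skip)
  then show ?case using Skip by (auto simp: halts_def)
next
  case (Compute r f a b)
  then have "exec W (Compute r f a b) (R, M) 1
      (R(r := arith_val f (operand_val R a) (operand_val R b)), M)"
    by (intro exec.Compute) auto
  then show ?case using Compute by (auto simp: halts_def)
next
  case (Load r a)
  then have "exec W (Load r a) (R, M) 1 (R(r := M (operand_val R a)), M)"
    by (intro exec.Load) auto
  then show ?case using Load by (auto simp: halts_def)
next
  case (Store a b)
  then have "exec W (Store a b) (R, M) 1 (R, M(operand_val R a := operand_val R b))"
    by (intro exec.Store) auto
  then show ?case using Store by (auto simp: halts_def)
next
  case (Seq P P')
  then have "halts W P R M (cost P) (wp W P' Q)" by simp
  then show ?case using halts_Seq Seq.IH(2) by simp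
next
  case (Branch b P P')
  have "halts W (Branch b P P') R M (1 + max (cost P) (cost P')) Q"
  proof (rule halts_Branch)
    show "halts W P R M (max (cost P) (cost P')) Q" if "cond_val R b"
      using that Branch.prems by (intro halts_mono[OF Branch.IH(1)]) auto
    show "halts W P' R M (max (cost P) (cost P')) Q" if "\<not> cond_val R b"
      using that Branch.prems by (intro halts_mono[OF Branch.IH(2)]) auto
  qed
  then show ?case by simp
qed simp

fun seq :: "program list \<Rightarrow> program" where
  "seq [] = Skip"
| "seq [P] = P"
| "seq (P # Ps) = Seq P (seq Ps)"

definition for_loop :: "nat \<Rightarrow> nat \<Rightarrow> program \<Rightarrow> program" where
  "for_loop i r P = Seq (Compute i Add (Const 0) (Const 0))
     (While (Less (Reg i) (Reg r)) (Seq P (Compute i Add (Reg i) (Const 1))))"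

text \<open>The increment follows \<open>P\<close>, so the body has to establish the next invariant
  with the counter already set to \<open>Suc j\<close>. Each iteration pays two more steps for test
  and increment; the final \<open>+ 2\<close> is the initialization and the failing test.\<close>

lemma halts_for_loop:
  assumes start: "I 0 (R(i := 0)) M" and i: "i \<noteq> r" and N: "R r = N" "N < W"
    and step: "\<And>j R M. j < N \<Longrightarrow> R i = j \<Longrightarrow> R r = N \<Longrightarrow> I j R M \<Longrightarrow>
      halts W P R M t (\<lambda>R' M'. R' i = j \<and> R' r = N \<and> I (Suc j) (R'(i := Suc j)) M')"
  shows "halts W (for_loop i r P) R M (N * (t + 2) + 2) (I N)"
proof -
  let ?b = "Less (Reg i) (Reg r)"
  let ?J = "\<lambda>R M. R i \<le> N \<and> R r = N \<and> I (R i) R M"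
  let ?inc = "Compute i Add (Reg i) (Const 1)"
  have "halts W (Compute i Add (Const 0) (Const 0)) R M 1 (\<lambda>R' M'. ?J R' M' \<and> R' i = 0)"
    using halts_wp[of W "Compute i Add (Const 0) (Const 0)"] start i N by simp
  moreover have "halts W (While ?b (Seq P ?inc)) R' M' (N * (t + 2) + 1) (I N)"
    if J: "?J R' M' \<and> R' i = 0" for R' M'
  proof -
    let ?K = "\<lambda>p R M. p = N - R i \<and> ?J R M"
    have "halts W (While ?b (Seq P ?inc)) R' M' (N * ((t + 1) + 1) + 1)
        (\<lambda>R M. \<exists>p. ?K p R M \<and> \<not> cond_val R ?b)"
    proof (rule halts_While)
      have z: "R' i = 0" and I: "I (R' i) R' M'" "R' r = N" using J by blast+
      show "?K N R' M'" using I by (simp add: z)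
      fix p R M assume K: "?K p R M" and "cond_val R ?b"
      then have lt: "R i < N" by simp
      show "halts W (Seq P ?inc) R M (t + 1) (\<lambda>R' M'. \<exists>p'<p. ?K p' R' M')"
      proof (rule halts_Seq)
        show "halts W P R M t (\<lambda>R' M'. R' i = R i \<and> R' r = N \<and> I (Suc (R i)) (R'(i := Suc (R i))) M')"
          using step[of "R i" R M] lt K by simp
        fix R' M' assume *: "R' i = R i \<and> R' r = N \<and> I (Suc (R i)) (R'(i := Suc (R i))) M'"
        have "wp W ?inc (\<lambda>R' M'. \<exists>p'<p. ?K p' R' M') R' M'"
          using * lt i N K by auto
        then show "halts W ?inc R' M' 1 (\<lambda>R' M'. \<exists>p'<p. ?K p' R' M')"
          using halts_wp[of W ?inc] by simp
      qed
    qed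
    then show ?thesis by (rule halts_mono) auto
  qed
  ultimately have "halts W (for_loop i r P) R M (1 + (N * (t + 2) + 1)) (I N)"
    unfolding for_loop_def by (rule halts_Seq)
  then show ?thesis by simp
qed

section \<open>The reduction as a program\<close>

definition load_cell :: "nat \<Rightarrow> nat \<Rightarrow> nat \<Rightarrow> program" where
  "load_cell r a b = seq [Compute r Mul (Reg a) (Reg 0), Compute r Add (Reg r) (Reg b),
     Compute r Add (Reg r) (Reg 2), Load r (Reg r)]"

definition store_cell :: "nat \<Rightarrow> nat \<Rightarrow> nat \<Rightarrow> program" where
  "store_cell a b v = seq [Compute 11 Mul (Reg a) (Reg 0), Compute 11 Add (Reg 11) (Reg b),
     Compute 11 Add (Reg 11) (Reg 2), Store (Reg 11) (Const v)]"

text \<open>Registers 0 to 5 hold \<open>n\<close>, \<open>k\<close> and the base addresses of the adjacency matrix, the marks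
  of the vertices in \<open>ini\<close> and \<open>fin\<close>, the marks of the visited vertices, and the stack.
  Register 6 is the height of the stack, and register 7 is set to 1 in the end.\<close>

definition prepare :: program where
  "prepare = seq [Load 0 (Const 0), Load 1 (Const 1), Compute 15 Mul (Const 2) (Reg 1),
     Compute 2 Add (Reg 15) (Reg 0), Compute 2 Add (Reg 2) (Const 2),
     Compute 3 Mul (Reg 0) (Reg 0), Compute 3 Add (Reg 3) (Reg 2),
     Compute 4 Add (Reg 3) (Reg 0), Compute 5 Add (Reg 4) (Reg 0)]"

definition mark_body :: program where
  "mark_body = seq [Compute 10 Add (Reg 8) (Const 2), Load 10 (Reg 10),
     Compute 11 Add (Reg 14) (Reg 0), Compute 11 Add (Reg 11) (Const 2), Load 11 (Reg 11),
     Branch (Equal (Reg 10) (Reg 11))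
       (seq [Compute 11 Add (Reg 3) (Reg 8), Store (Reg 11) (Const 1)]) Skip]"

definition mark :: program where
  "mark = for_loop 8 0 (for_loop 14 15 mark_body)"

definition reset_body :: program where
  "reset_body = seq [Compute 10 Add (Reg 3) (Reg 8), Load 10 (Reg 10),
     Compute 11 Add (Reg 4) (Reg 8), Store (Reg 11) (Reg 10)]"

definition reset :: program where
  "reset = Seq (for_loop 8 0 reset_body) (Compute 6 Add (Const 0) (Const 0))"

text \<open>The value \<open>n\<close> in register 9 is no position and means that no vertex has
  been found. The scan does not stop early, so the last suitable vertex wins. Register 12 gets the
  top of a nonempty stack.\<close>

definition find_init :: program where
  "find_init = seq [Compute 9 Add (Reg 0) (Const 0), Branch (Equal (Reg 6) (Const 0)) Skip
     (seq [Compute 12 Add (Reg 5) (Reg 6), Compute 12 Sub (Reg 12) (Const 1), Load 12 (Reg 12)])]"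

definition find_body :: program where
  "find_body = seq [Compute 10 Add (Reg 4) (Reg 8), Load 10 (Reg 10),
     Branch (Equal (Reg 10) (Const 0))
       (Branch (Equal (Reg 6) (Const 0)) (Compute 9 Add (Reg 8) (Const 0))
         (seq [load_cell 10 12 8,
           Branch (Equal (Reg 10) (Const 1)) (Compute 9 Add (Reg 8) (Const 0)) Skip]))
       Skip]"

definition find :: program where
  "find = Seq find_init (for_loop 8 0 find_body)"

text \<open>The stack is stored bottom first, so the vertices at least \<open>k\<close> below the
  top are those with offset less than its height minus \<open>k\<close>. For a height of at most
  \<open>k\<close>, truncated subtraction makes the scan empty.\<close>

definition far_init :: program where
  "far_init = seq [Compute 13 Add (Const 0) (Const 0), Compute 15 Sub (Reg 6) (Reg 1)]"

definition far_body :: program where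
  "far_body = seq [Compute 10 Add (Reg 5) (Reg 8), Load 11 (Reg 10), load_cell 10 9 11,
     Branch (Equal (Reg 10) (Const 1)) (Compute 13 Add (Const 1) (Const 0)) Skip]"

definition far :: program where
  "far = Seq far_init (for_loop 8 15 far_body)"

definition merge_body :: program where
  "merge_body = seq [load_cell 10 9 8,
     Branch (Equal (Reg 10) (Const 1))
       (seq [Branch (Equal (Reg 8) (Reg 12)) Skip (seq [store_cell 12 8 1, store_cell 8 12 1]),
         store_cell 9 8 0, store_cell 8 9 0])
       Skip]"

definition merge :: program where
  "merge = for_loop 8 0 merge_body"

definition push :: program where
  "push = seq [Compute 10 Add (Reg 4) (Reg 9), Store (Reg 10) (Const 1),
     Compute 10 Add (Reg 5) (Reg 6), Store (Reg 10) (Reg 9), Compute 6 Add (Reg 6) (Const 1)]"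

definition pop_or_stop :: program where
  "pop_or_stop = Branch (Equal (Reg 6) (Const 0)) (Compute 7 Add (Const 1) (Const 0))
     (Compute 6 Sub (Reg 6) (Const 1))"

definition dfs_step :: program where
  "dfs_step = Seq find (Branch (Equal (Reg 9) (Reg 0)) pop_or_stop
     (Seq far (Branch (Equal (Reg 13) (Const 1)) (Seq merge reset) push)))"

definition reduce :: program where
  "reduce = Seq prepare (Seq mark (Seq reset (While (Equal (Reg 7) (Const 0)) dfs_step)))"

section \<open>Memory layout and the procedures of one search step\<close>

lemma cell_less:
  fixes n :: nat
  assumes "i < n" "j < n"
  shows "i * n + j < n * n"
proof -
  have "i * n + j < i * n + n" using assms by simp
  also have "\<dots> = Suc i * n" by simp
  also have "\<dots> \<le> n * n" using assms by (intro mult_right_mono) auto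
  finally show ?thesis .
qed

lemma cell_inject:
  fixes n :: nat
  assumes "j < n" "j' < n"
  shows "i * n + j = i' * n + j' \<longleftrightarrow> i = i' \<and> j = j'"
proof
  assume "i * n + j = i' * n + j'"
  then have "(i * n + j) div n = (i' * n + j') div n" "(i * n + j) mod n = (i' * n + j') mod n"
    by simp_all
  then show "i = i' \<and> j = j'" using assms by simp
qed auto

text \<open>The matrix takes \<open>n * n\<close> cells and, by \<open>k \<le> n\<close>, everything
  else is linear in \<open>n\<close>, so all addresses stay below
  \<open>(n + 2) ^ 3\<close>.\<close>

locale layout =
  fixes n k W :: nat and xs :: "nat list"
  assumes k_le: "k \<le> n" and W: "(n + 2) ^ 3 \<le> W"
begin

definition "base = 2 * k + n + 2"
definition "marks = n * n + base"
definition "seen = marks + n"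
definition "stack = seen + n"

text \<open>The input is transformed in place: its first \<open>base\<close> cells never change and
  the matrix cells behind them are overwritten, so that memory finally begins with the output. Cells
  above the stack are unconstrained, so a pop erases nothing.\<close>

definition mem :: "(nat \<Rightarrow> nat \<Rightarrow> bool) \<Rightarrow> nat set \<Rightarrow> nat set \<Rightarrow> nat list \<Rightarrow> (nat \<Rightarrow> nat) \<Rightarrow> bool" where
  "mem A Z V st M \<longleftrightarrow> (\<forall>i<base. M i = xs ! i) \<and>
     (\<forall>i<n. \<forall>j<n. M (i * n + j + base) = of_bool (A i j)) \<and>
     (\<forall>i<n. M (marks + i) = of_bool (i \<in> Z)) \<and>
     (\<forall>i<n. M (seen + i) = of_bool (i \<in> V)) \<and>
     (\<forall>p<length st. M (stack + p) = rev st ! p)"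

definition regs :: "(nat \<Rightarrow> nat) \<Rightarrow> bool" where
  "regs R \<longleftrightarrow> R 0 = n \<and> R 1 = k \<and> R 2 = base \<and> R 3 = marks \<and> R 4 = seen \<and> R 5 = stack"

lemma bounds:
  "n < W" "0 < W" "Suc 0 < W" "base < W"
  "i < n \<Longrightarrow> i < W" "i < n \<Longrightarrow> Suc i < W"
  "i < n \<Longrightarrow> marks + i < W" "i < n \<Longrightarrow> seen + i < W" "i \<le> n \<Longrightarrow> stack + i < W"
  "i < n \<Longrightarrow> i * n < W" "i < n \<Longrightarrow> j < n \<Longrightarrow> i * n + j < W"
  "i < n \<Longrightarrow> j < n \<Longrightarrow> i * n + j + base < W" "i \<le> 2 * n \<Longrightarrow> i + n + 2 < W"
  "i \<le> 2 * n \<Longrightarrow> i < W"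
  "i \<le> 2 * n \<Longrightarrow> i + n < W" "i < n \<Longrightarrow> Suc (Suc i) < W"
  "n * n < W" "marks < W" "seen < W" "stack < W"
proof -
  have "(n + 2) ^ 3 = n * (n * n) + 6 * (n * n) + 12 * n + 8"
    by (simp add: power3_eq_cube algebra_simps)
  moreover have "n * n \<ge> n" by (cases n) auto
  ultimately have *: "n * n + 12 * n + 8 \<le> W" using W by linarith
  have cell: "i * n + j < n * n" if "i < n" "j < n" for i j using cell_less that .
  show "n < W" "0 < W" "Suc 0 < W" "base < W"
    "i < n \<Longrightarrow> i < W" "i < n \<Longrightarrow> Suc i < W"
    "i < n \<Longrightarrow> marks + i < W" "i < n \<Longrightarrow> seen + i < W" "i \<le> n \<Longrightarrow> stack + i < W"
    "i \<le> 2 * n \<Longrightarrow> i + n + 2 < W" "i \<le> 2 * n \<Longrightarrow> i < W"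
    "i \<le> 2 * n \<Longrightarrow> i + n < W" "i < n \<Longrightarrow> Suc (Suc i) < W"
    "n * n < W" "marks < W" "seen < W" "stack < W"
    using * k_le by (simp_all add: base_def marks_def seen_def stack_def)
  show "i * n < W" if "i < n"
  proof -
    have "i * n + 0 < n * n" using that by (intro cell) auto
    then show ?thesis using * by linarith
  qed
  show "i < n \<Longrightarrow> j < n \<Longrightarrow> i * n + j < W" using cell[of i j] * by auto
  show "i < n \<Longrightarrow> j < n \<Longrightarrow> i * n + j + base < W"
    using cell[of i j] * k_le by (simp add: base_def)
qed

lemmas addresses = base_def marks_def seen_def stack_def

lemma mem_read:
  assumes "mem A Z V st M"
  shows "i < base \<Longrightarrow> M i = xs ! i"
    "i < n \<Longrightarrow> j < n \<Longrightarrow> M (i * n + j + base) = of_bool (A i j)"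
    "i < n \<Longrightarrow> M (marks + i) = of_bool (i \<in> Z)"
    "i < n \<Longrightarrow> M (seen + i) = of_bool (i \<in> V)"
    "p < length st \<Longrightarrow> M (stack + p) = rev st ! p"
  using assms by (auto simp: mem_def)

lemma mem_write_cell:
  assumes "mem A Z V st M" "a < n" "b < n" "x = of_bool c"
  shows "mem (\<lambda>i j. if i = a \<and> j = b then c else A i j) Z V st (M(a * n + b + base := x))"
proof -
  have "a * n + b < n * n" using assms by (intro cell_less)
  then have "i < base \<Longrightarrow> i \<noteq> a * n + b + base" "marks + i \<noteq> a * n + b + base"
    "seen + i \<noteq> a * n + b + base" "stack + i \<noteq> a * n + b + base" for i
    by (auto simp: addresses)
  moreover have "i * n + j + base = a * n + b + base \<longleftrightarrow> i = a \<and> j = b" if "j < n" for i j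
    using cell_inject[OF that assms(3)] by simp
  ultimately show ?thesis using assms unfolding mem_def by simp
qed

lemma mem_write_mark:
  assumes "mem A Z V st M" "a < n"
  shows "mem A (insert a Z) V st (M(marks + a := Suc 0))"
proof -
  have "i < base \<Longrightarrow> i \<noteq> marks + a" "seen + i \<noteq> marks + a" "stack + i \<noteq> marks + a" for i
    using assms(2) by (auto simp: addresses)
  moreover have "i * n + j + base \<noteq> marks + a" if "i < n" "j < n" for i j
    using cell_less[OF that] by (simp add: marks_def)
  ultimately show ?thesis using assms unfolding mem_def by simp
qed

lemma mem_write_seen:
  assumes "mem A Z V st M" "a < n" "x = of_bool c"
  shows "mem A Z (if c then insert a V else V - {a}) st (M(seen + a := x))"
proof -
  have "i < base \<Longrightarrow> i \<noteq> seen + a" "i < n \<Longrightarrow> marks + i \<noteq> seen + a" "stack + i \<noteq> seen + a" for i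
    using assms(2) by (auto simp: addresses)
  moreover have "i * n + j + base \<noteq> seen + a" if "i < n" "j < n" for i j
    using cell_less[OF that] by (simp add: marks_def seen_def)
  ultimately show ?thesis using assms unfolding mem_def by auto
qed

lemma mem_push:
  assumes "mem A Z V st M"
  shows "mem A Z V (w # st) (M(stack + length st := w))"
proof -
  let ?a = "stack + length st"
  have "i < base \<Longrightarrow> i \<noteq> ?a" "i < n \<Longrightarrow> marks + i \<noteq> ?a" "i < n \<Longrightarrow> seen + i \<noteq> ?a" for i
    by (auto simp: addresses)
  moreover have "i * n + j + base \<noteq> ?a" if "i < n" "j < n" for i j
    using cell_less[OF that] by (simp add: addresses)
  ultimately show ?thesis using assms unfolding mem_def by (auto simp: nth_append)
qed

lemma mem_pop: "mem A Z V (w # st) M \<Longrightarrow> mem A Z V st M"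
  unfolding mem_def by (auto simp: nth_append)

lemma mem_clear_stack: "mem A Z V st M \<Longrightarrow> mem A Z V [] M"
  by (auto simp: mem_def)

definition state :: "(nat \<Rightarrow> nat \<Rightarrow> bool) \<Rightarrow> nat set \<Rightarrow> nat set \<Rightarrow> nat list \<Rightarrow>
    (nat \<Rightarrow> nat) \<Rightarrow> (nat \<Rightarrow> nat) \<Rightarrow> bool" where
  "state A Z V st R M \<longleftrightarrow> regs R \<and> R 6 = length st \<and> R 7 = 0 \<and> mem A Z V st M"

lemmas state_simps = state_def regs_def

text \<open>With an empty stack every unvisited vertex qualifies and starts a new tree, since the
  graph outside \<open>ini\<close> and \<open>fin\<close> may be disconnected.\<close>

definition candidate :: "(nat \<Rightarrow> nat \<Rightarrow> bool) \<Rightarrow> nat set \<Rightarrow> nat list \<Rightarrow> nat \<Rightarrow> bool" where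
  "candidate A V st w \<longleftrightarrow> w < n \<and> w \<notin> V \<and> (st = [] \<or> A (hd st) w)"

lemma halts_find:
  assumes st: "state A Z V st R M" "set st \<subseteq> {..<n}" "length st \<le> n"
  shows "halts W find R M (cost find_init + (n * (cost find_body + 2) + 2))
    (\<lambda>R' M'. M' = M \<and> state A Z V st R' M \<and> (st \<noteq> [] \<longrightarrow> R' 12 = hd st) \<and>
      (R' 9 = n \<and> (\<forall>w. \<not> candidate A V st w) \<or> candidate A V st (R' 9)))"
proof -
  let ?I = "\<lambda>j R' M'. M' = M \<and> state A Z V st R' M \<and> (st \<noteq> [] \<longrightarrow> R' 12 = hd st) \<and>
      (R' 9 = n \<and> (\<forall>w<j. \<not> candidate A V st w) \<or> candidate A V st (R' 9))"
  have top: "M (stack + length st - Suc 0) = hd st" if "st \<noteq> []"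
  proof -
    have "M (stack + (length st - Suc 0)) = hd st"
      using that st(1) by (cases st) (auto simp: state_def mem_read(5) nth_append)
    then show ?thesis using that by (cases st) auto
  qed
  have "wp W find_init (?I 0) R M"
    using st top bounds(1,9,20) bounds(9)[of "length st"]
    by (auto simp: find_init_def state_simps less_imp_diff_less)
  then have 1: "halts W find_init R M (cost find_init) (?I 0)" by (rule halts_wp)
  have 2: "halts W (for_loop 8 0 find_body) R' M' (n * (cost find_body + 2) + 2) (?I n)"
    if I: "?I 0 R' M'" for R' M'
  proof (rule halts_for_loop[where I = ?I and N = n])
    show "?I 0 (R'(8 := 0)) M'" "R' 0 = n" using I by (auto simp: state_simps)
    fix j R1 M1 assume j: "j < n" "R1 8 = j" and I: "?I j R1 M1"
    have hd: "st \<noteq> [] \<Longrightarrow> hd st < n" using st(2) by (cases st) auto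
    have "mem A Z V st M" using I by (simp add: state_def)
    note read = mem_read[OF this]
    have cand: "candidate A V st j \<longleftrightarrow> j \<notin> V \<and> (st = [] \<or> A (hd st) j)"
      using j by (simp add: candidate_def)
    have "wp W find_body (\<lambda>R2 M2. R2 8 = j \<and> R2 0 = n \<and> ?I (Suc j) (R2(8 := Suc j)) M2) R1 M1"
      using I j hd bounds cand read
      by (auto simp: find_body_def load_cell_def state_simps less_Suc_eq)
    then show "halts W find_body R1 M1 (cost find_body)
        (\<lambda>R2 M2. R2 8 = j \<and> R2 0 = n \<and> ?I (Suc j) (R2(8 := Suc j)) M2)"
      by (rule halts_wp)
  qed (use bounds in auto)
  show ?thesis
    unfolding find_def
    by (rule halts_mono[OF halts_Seq[OF 1 2]]) (auto simp: candidate_def)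
qed

lemma halts_far:
  assumes st: "state A Z V st R M" "set st \<subseteq> {..<n}" "length st \<le> n" and w: "R 9 = w" "w < n"
  shows "halts W far R M (cost far_init + (n * (cost far_body + 2) + 2))
    (\<lambda>R' M'. M' = M \<and> state A Z V st R' M \<and> R' 9 = w \<and> R' 12 = R 12 \<and>
      R' 13 = of_bool (\<exists>i. k \<le> i \<and> i < length st \<and> A w (st ! i)))"
proof -
  let ?N = "length st - k"
  let ?I = "\<lambda>j R' M'. M' = M \<and> state A Z V st R' M \<and> R' 9 = w \<and> R' 12 = R 12 \<and> R' 15 = ?N \<and>
      R' 13 = of_bool (\<exists>p<j. A w (rev st ! p))"
  have N: "?N < W" using st(3) bounds(1) by simp
  have "mem A Z V st M" using st(1) by (simp add: state_def)
  note read = mem_read[OF this]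
  have "wp W far_init (?I 0) R M"
    using st w bounds(2) N by (simp add: far_init_def state_simps)
  then have 1: "halts W far_init R M (cost far_init) (?I 0)" by (rule halts_wp)
  have 2: "halts W (for_loop 8 15 far_body) R' M' (?N * (cost far_body + 2) + 2) (?I ?N)"
    if I: "?I 0 R' M'" for R' M'
  proof (rule halts_for_loop[where I = ?I and N = ?N])
    show "?I 0 (R'(8 := 0)) M'" "R' 15 = ?N" using I by (auto simp: state_simps)
    fix j R1 M1 assume j: "j < ?N" "R1 8 = j" and I: "?I j R1 M1"
    have "j < length (rev st)" using j by simp
    then have "rev st ! j \<in> set (rev st)" by (rule nth_mem)
    then have v: "rev st ! j < n" using st(2) by auto
    have j': "j < length st" "j < n" using j st(3) by auto
    have "wp W far_body (\<lambda>R2 M2. R2 8 = j \<and> R2 15 = ?N \<and> ?I (Suc j) (R2(8 := Suc j)) M2) R1 M1"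
      using I j j' v w bounds read
      by (auto simp: far_body_def load_cell_def state_simps less_Suc_eq)
    then show "halts W far_body R1 M1 (cost far_body)
        (\<lambda>R2 M2. R2 8 = j \<and> R2 15 = ?N \<and> ?I (Suc j) (R2(8 := Suc j)) M2)"
      by (rule halts_wp)
  qed (use N in auto)
  have "?N * (cost far_body + 2) \<le> n * (cost far_body + 2)"
    using st(3) by (intro mult_right_mono) auto
  \<comment> \<open>The offset \<open>p\<close> from the bottom is the depth
    \<open>length st - Suc p\<close> below the top.\<close>
  moreover have "(\<exists>p<?N. A w (rev st ! p)) \<longleftrightarrow> (\<exists>i. k \<le> i \<and> i < length st \<and> A w (st ! i))"
  proof
    assume "\<exists>p<?N. A w (rev st ! p)"
    then obtain p where "p < ?N" "A w (rev st ! p)" by blast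
    then show "\<exists>i. k \<le> i \<and> i < length st \<and> A w (st ! i)"
      by (intro exI[of _ "length st - Suc p"]) (auto simp: rev_nth)
  next
    assume "\<exists>i. k \<le> i \<and> i < length st \<and> A w (st ! i)"
    then obtain i where "k \<le> i" "i < length st" "A w (st ! i)" by blast
    then show "\<exists>p<?N. A w (rev st ! p)"
      by (intro exI[of _ "length st - Suc i"]) (auto simp: rev_nth)
  qed
  ultimately show ?thesis
    unfolding far_def by (intro halts_mono[OF halts_Seq[OF 1 2]]) auto
qed

text \<open>\<open>contract A u w\<close> as far as it has been carried out for the indices below \<open>j\<close>.\<close>

definition merged :: "(nat \<Rightarrow> nat \<Rightarrow> bool) \<Rightarrow> nat \<Rightarrow> nat \<Rightarrow> nat \<Rightarrow> nat \<Rightarrow> nat \<Rightarrow> bool" where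
  "merged A u w j a b \<longleftrightarrow> \<not> (a = w \<and> b < j) \<and> \<not> (b = w \<and> a < j) \<and>
     (A a b \<or> a = u \<and> b < j \<and> b \<noteq> u \<and> A w b \<or> b = u \<and> a < j \<and> a \<noteq> u \<and> A w a)"

lemma halts_merge:
  assumes A: "simple_rel n A" and st: "state A Z V st R M"
    and w: "R 9 = w" "w < n" and u: "R 12 = u" "u < n" "u \<noteq> w"
  shows "halts W merge R M (n * (cost merge_body + 2) + 2) (state (contract A u w) Z V st)"
proof -
  let ?I = "\<lambda>j R' M'. state (merged A u w j) Z V st R' M' \<and> R' 9 = w \<and> R' 12 = u"
  have "halts W (for_loop 8 0 merge_body) R M (n * (cost merge_body + 2) + 2) (?I n)"
  proof (rule halts_for_loop[where I = ?I and N = n])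
    have "merged A u w 0 = A" by (auto simp: merged_def fun_eq_iff)
    then show "?I 0 (R(8 := 0)) M" "R 0 = n" using st w u by (auto simp: state_simps)
    fix j R1 M1 assume j: "j < n" "R1 8 = j" and I: "?I j R1 M1"
    have irr: "\<not> A w w" "\<not> A u u" using simple_rel_irrefl[OF A] w u by auto
    have sym: "A j w \<longleftrightarrow> A w j" using simple_rel_sym[OF A] j w by blast
    have m: "mem (merged A u w j) Z V st M1" using I by (simp add: state_def)
    note read = mem_read(2)[OF m w(2) j(1)]
    \<comment> \<open>Earlier iterations leave the entry at row \<open>w\<close> and column
      \<open>j\<close> as it was, so the original edge is tested although the matrix is overwritten
      during the scan.\<close>
    have wj: "merged A u w j w j \<longleftrightarrow> A w j" using irr u by (auto simp: merged_def)
    note update = mem_write_cell[where a = w and b = j and c = False and x = 0,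
        THEN mem_write_cell[where a = j and b = w and c = False and x = 0]]
    have no: "merged A u w (Suc j) = merged A u w j" if "\<not> A w j"
      using that irr sym by (auto simp: merged_def fun_eq_iff less_Suc_eq)
    have at_u: "mem (merged A u w (Suc j)) Z V st (M1(w * n + j + base := 0, j * n + w + base := 0))"
      if "A w j" "j = u"
    proof -
      have "merged A u w (Suc j) = (\<lambda>a b. if a = j \<and> b = w then False else if a = w \<and> b = j then False
          else merged A u w j a b)"
        using that irr by (auto simp: merged_def fun_eq_iff less_Suc_eq)
      then show ?thesis using update[OF m] w j by simp
    qed
    have not_u: "mem (merged A u w (Suc j)) Z V st (M1(u * n + j + base := Suc 0, j * n + u + base := Suc 0,
        w * n + j + base := 0, j * n + w + base := 0))"
      if "A w j" "j \<noteq> u"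
    proof -
      have jw: "j \<noteq> w" using that irr by auto
      have eq: "merged A u w (Suc j) = (\<lambda>a b. if a = j \<and> b = w then False else if a = w \<and> b = j then False
          else if a = j \<and> b = u then True else if a = u \<and> b = j then True else merged A u w j a b)"
        using that irr jw u by (auto simp: merged_def fun_eq_iff less_Suc_eq)
      have "mem (\<lambda>a b. if a = j \<and> b = u then True else if a = u \<and> b = j then True else merged A u w j a b)
          Z V st (M1(u * n + j + base := Suc 0, j * n + u + base := Suc 0))"
        by (rule mem_write_cell[OF mem_write_cell[OF m u(2) j(1)] j(1) u(2)]) simp_all
      from update[OF this w(2) j(1) _ j(1) w(2)] show ?thesis unfolding eq by simp
    qed
    have "wp W merge_body (\<lambda>R2 M2. R2 8 = j \<and> R2 0 = n \<and> ?I (Suc j) (R2(8 := Suc j)) M2) R1 M1"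
    proof (cases "A w j")
      case False
      then show ?thesis using I j w u bounds read wj no
        by (simp add: merge_body_def load_cell_def state_simps)
    next
      case True
      then show ?thesis using I j w u bounds read wj at_u not_u
        by (cases "j = u") (simp_all add: merge_body_def load_cell_def store_cell_def state_simps)
    qed
    then show "halts W merge_body R1 M1 (cost merge_body)
        (\<lambda>R2 M2. R2 8 = j \<and> R2 0 = n \<and> ?I (Suc j) (R2(8 := Suc j)) M2)"
      by (rule halts_wp)
  qed (use bounds in auto)
  moreover have "state (contract A u w) Z V st R' M'" if "?I n R' M'" for R' M'
    using that unfolding state_def mem_def by (simp add: merged_def contract_def)
  ultimately show ?thesis unfolding merge_def by (blast intro: halts_mono)
qed

lemma halts_reset:
  assumes st: "state A Z V st R M" "Z \<subseteq> {..<n}" "V \<subseteq> {..<n}"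
  shows "halts W reset R M (n * (cost reset_body + 2) + 3) (state A Z Z [])"
proof -
  let ?V = "\<lambda>j. {i. if i < j then i \<in> Z else i \<in> V}"
  let ?I = "\<lambda>j R' M'. state A Z (?V j) st R' M'"
  have 1: "halts W (for_loop 8 0 reset_body) R M (n * (cost reset_body + 2) + 2) (?I n)"
  proof (rule halts_for_loop[where I = ?I and N = n])
    show "?I 0 (R(8 := 0)) M" "R 0 = n" using st by (auto simp: state_simps)
    fix j R1 M1 assume j: "j < n" "R1 8 = j" and I: "?I j R1 M1"
    have m: "mem A Z (?V j) st M1" using I by (simp add: state_def)
    note read = mem_read(3)[OF m j(1)]
    have "?V (Suc j) = (if j \<in> Z then insert j (?V j) else ?V j - {j})"
      by (auto simp: less_Suc_eq)
    then have update: "mem A Z (?V (Suc j)) st (M1(seen + j := of_bool (j \<in> Z)))"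
      using mem_write_seen[OF m j(1) refl, of "j \<in> Z"] by (simp only:)
    have "of_bool (j \<in> Z) < W" using bounds(2,3) by simp
    then have "wp W reset_body (\<lambda>R2 M2. R2 8 = j \<and> R2 0 = n \<and> ?I (Suc j) (R2(8 := Suc j)) M2) R1 M1"
      using I j bounds read update by (simp add: reset_body_def state_simps del: of_bool_less_one_iff)
    then show "halts W reset_body R1 M1 (cost reset_body)
        (\<lambda>R2 M2. R2 8 = j \<and> R2 0 = n \<and> ?I (Suc j) (R2(8 := Suc j)) M2)"
      by (rule halts_wp)
  qed (use bounds in auto)
  have 2: "halts W (Compute 6 Add (Const 0) (Const 0)) R' M' 1 (state A Z Z [])" if "?I n R' M'" for R' M'
  proof -
    have "?V n = Z" using st(2,3) by auto
    then have "mem A Z Z st M'" using that by (simp add: state_def)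
    then have "mem A Z Z [] M'" by (rule mem_clear_stack)
    then have "wp W (Compute 6 Add (Const 0) (Const 0)) (state A Z Z []) R' M'"
      using that bounds(2) by (simp add: state_simps)
    then show ?thesis using halts_wp[of W "Compute 6 Add (Const 0) (Const 0)"] by simp
  qed
  show ?thesis unfolding reset_def by (rule halts_mono[OF halts_Seq[OF 1 2]]) auto
qed

lemma halts_push:
  assumes "state A Z V st R M" "R 9 = w" "w < n" "length st < n"
  shows "halts W push R M (cost push) (state A Z (insert w V) (w # st))"
proof (rule halts_wp)
  have m: "mem A Z V st M" using assms by (simp add: state_def)
  have "mem A Z (insert w V) (w # st) (M(seen + w := Suc 0, stack + length st := w))"
    using mem_push[OF mem_write_seen[OF m assms(3), of "Suc 0" True]] by simp
  then show "wp W push (state A Z (insert w V) (w # st)) R M"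
    using assms bounds bounds(9)[of "length st"] by (simp add: push_def state_simps)
qed

end

section \<open>Time bounds\<close>

definition find_time :: "nat \<Rightarrow> nat" where
  "find_time n = cost find_init + (n * (cost find_body + 2) + 2)"

definition far_time :: "nat \<Rightarrow> nat" where
  "far_time n = cost far_init + (n * (cost far_body + 2) + 2)"

definition merge_time :: "nat \<Rightarrow> nat" where
  "merge_time n = n * (cost merge_body + 2) + 2"

definition reset_time :: "nat \<Rightarrow> nat" where
  "reset_time n = n * (cost reset_body + 2) + 3"

text \<open>Times of alternative branches are added instead of maximized, which makes the bound a
  linear polynomial in \<open>n\<close>.\<close>

definition step_time :: "nat \<Rightarrow> nat" where
  "step_time n = find_time n + (1 + (cost pop_or_stop +
     (far_time n + (1 + (merge_time n + reset_time n + cost push)))))"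

text \<open>The inner loop runs over the \<open>2 * k\<close> entries of \<open>ini\<close> and
  \<open>fin\<close>; the factor \<open>2 * n\<close> makes the bound independent of
  \<open>k\<close>.\<close>

definition mark_time :: "nat \<Rightarrow> nat" where
  "mark_time n = n * (2 * n * (cost mark_body + 2) + 4) + 2"

text \<open>A bound on the initial potential: at most \<open>n\<close> vertices with edges, each
  worth \<open>2 * n + 1\<close>, and at most \<open>2 * n + 1\<close> for the first search.\<close>

definition steps :: "nat \<Rightarrow> nat" where
  "steps n = n * (2 * n + 1) + (2 * n + 1)"

definition reduce_time :: "nat \<Rightarrow> nat" where
  "reduce_time n = cost prepare + (mark_time n + (reset_time n + (steps n * (step_time n + 1) + 1)))"

lemma reduce_time_bigo: "(\<lambda>n. real (reduce_time n)) \<in> O(\<lambda>n. real n ^ 3)"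
proof -
  have mono: "(\<lambda>n. real n ^ i) \<in> O(\<lambda>n. real n ^ 3)" if "i \<le> 3" for i
    using that
    by (intro bigoI[of _ 1] eventually_mono[OF eventually_ge_at_top[of 1]]) (auto intro: power_increasing)
  have lin: "(\<lambda>n. real (n * a + b)) \<in> O(\<lambda>n. real n)" for a b
  proof (rule bigoI[of _ "real (a + b)"])
    show "\<forall>\<^sub>F n in at_top. norm (real (n * a + b)) \<le> real (a + b) * norm (real n)"
      using eventually_ge_at_top[of 1]
    proof eventually_elim
      case (elim n)
      then have "real b \<le> real b * real n" by (simp add: mult_le_cancel_left1)
      then show ?case by (simp add: algebra_simps)
    qed
  qed
  have const: "(\<lambda>n. real b) \<in> O(\<lambda>n. real n ^ 3)" for b
    using mono[of 0] by (auto intro: landau_o.big_trans[of _ _ "\<lambda>_. 1"])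
  have up: "f \<in> O(\<lambda>n. real n ^ 3)" if "f \<in> O(\<lambda>n. real n ^ i)" "i \<le> 3" for f i
    using landau_o.big_trans[OF that(1) mono[OF that(2)]] .
  have "step_time n + 1 = n * (cost find_body + cost far_body + cost merge_body + cost reset_body + 8) +
      (cost find_init + cost far_init + cost pop_or_stop + cost push + 12)" for n
    by (simp add: step_time_def find_time_def far_time_def merge_time_def reset_time_def algebra_simps)
  then have step: "(\<lambda>n. real (step_time n + 1)) \<in> O(\<lambda>n. real n)"
    using lin by (simp only:)
  have "real (steps n) = real (n * 1 + 1) * real (n * 2 + 1)" for n
    by (simp add: steps_def algebra_simps)
  then have "(\<lambda>n. real (steps n)) \<in> O(\<lambda>n. real n * real n)"
    using landau_o.big.mult[OF lin lin, of 1 1 2 1] by (simp only:)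
  then have "(\<lambda>n. real (steps n) * real (step_time n + 1)) \<in> O(\<lambda>n. real n * real n * real n)"
    using step by (rule landau_o.big.mult)
  then have main: "(\<lambda>n. real (steps n) * real (step_time n + 1)) \<in> O(\<lambda>n. real n ^ 3)"
    by (simp add: power3_eq_cube)
  have "(\<lambda>n. real (n * 1 + 0) * real (n * (2 * (cost mark_body + 2)) + 4)) \<in> O(\<lambda>n. real n * real n)"
    by (intro landau_o.big.mult lin)
  then have "(\<lambda>n. real (n * 1 + 0) * real (n * (2 * (cost mark_body + 2)) + 4)) \<in> O(\<lambda>n. real n ^ 3)"
    by (intro up[of _ 2]) (simp_all add: power2_eq_square)
  then have mark: "(\<lambda>n. real (n * 1 + 0) * real (n * (2 * (cost mark_body + 2)) + 4) + real 2) \<in> O(\<lambda>n. real n ^ 3)"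
    using const by (rule sum_in_bigo)
  have reset: "(\<lambda>n. real (reset_time n)) \<in> O(\<lambda>n. real n ^ 3)"
    unfolding reset_time_def by (rule up[of _ 1]) (use lin in \<open>simp_all only: power_one_right one_le_numeral\<close>)
  have "(\<lambda>n. real (cost prepare) + ((real (n * 1 + 0) * real (n * (2 * (cost mark_body + 2)) + 4) + real 2) +
      (real (reset_time n) + (real (steps n) * real (step_time n + 1) + real 1)))) \<in> O(\<lambda>n. real n ^ 3)"
    by (intro sum_in_bigo const mark reset main)
  moreover have "real (reduce_time n) = real (cost prepare) +
      ((real (n * 1 + 0) * real (n * (2 * (cost mark_body + 2)) + 4) + real 2) +
      (real (reset_time n) + (real (steps n) * real (step_time n + 1) + real 1)))" for n
    by (simp add: reduce_time_def mark_time_def algebra_simps)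
  ultimately show ?thesis by (simp only:)
qed

section \<open>Marking, the main loop and its potential\<close>

context layout
begin

text \<open>The vertex with index \<open>i\<close> is stored at \<open>i + 2\<close>, and \<open>ini @ fin\<close> starts at \<open>n + 2\<close>.\<close>

definition hit :: "nat \<Rightarrow> nat \<Rightarrow> bool" where
  "hit i j \<longleftrightarrow> (\<exists>l<j. xs ! (i + 2) = xs ! (l + n + 2))"

definition ends :: "nat set" where
  "ends = {i. i < n \<and> hit i (2 * k)}"

lemma ends_subset: "ends \<subseteq> {..<n}"
  by (auto simp: ends_def)

lemma halts_mark:
  assumes st: "state A {} {} [] R M" "R 15 = 2 * k"
  shows "halts W mark R M (mark_time n) (state A ends {} [])"
proof -
  \<comment> \<open>The marks after \<open>i\<close> complete rounds and \<open>j\<close>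
    comparisons in the round for vertex \<open>i\<close>.\<close>
  let ?Z = "\<lambda>i j. {a. a < i \<and> hit a (2 * k) \<or> a = i \<and> hit a j}"
  let ?I = "\<lambda>i R' M'. state A {a. a < i \<and> hit a (2 * k)} {} [] R' M' \<and> R' 15 = 2 * k"
  have kW: "2 * k < W" using bounds(14) k_le by simp
  have "halts W (for_loop 8 0 (for_loop 14 15 mark_body)) R M
      (n * ((2 * k * (cost mark_body + 2) + 2) + 2) + 2) (?I n)"
  proof (rule halts_for_loop[where I = ?I and N = n])
    show "?I 0 (R(8 := 0)) M" "R 0 = n" using st by (auto simp: state_simps)
    fix i R1 M1 assume i: "i < n" "R1 8 = i" and I: "?I i R1 M1"
    let ?J = "\<lambda>j R' M'. state A (?Z i j) {} [] R' M' \<and> R' 15 = 2 * k \<and> R' 8 = i"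
    have "halts W (for_loop 14 15 mark_body) R1 M1 (2 * k * (cost mark_body + 2) + 2) (?J (2 * k))"
    proof (rule halts_for_loop[where I = ?J and N = "2 * k"])
      have "?Z i 0 = {a. a < i \<and> hit a (2 * k)}" by (auto simp: hit_def)
      then show "?J 0 (R1(14 := 0)) M1" "R1 15 = 2 * k"
        using I i by (simp_all add: state_simps)
      fix j R2 M2 assume j: "j < 2 * k" "R2 14 = j" and J: "?J j R2 M2"
      have m: "mem A (?Z i j) {} [] M2" using J by (simp add: state_def)
      have rd: "M2 (Suc (Suc i)) = xs ! (i + 2)" "M2 (Suc (Suc (j + n))) = xs ! (j + n + 2)"
        using mem_read(1)[OF m, of "i + 2"] mem_read(1)[OF m, of "j + n + 2"] i j k_le
        by (simp_all add: base_def)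
      have jb: "j + n < W" "Suc (Suc (j + n)) < W" using bounds(13)[of j] j k_le by simp_all
      have Suc: "?Z i (Suc j) = (if xs ! (i + 2) = xs ! (j + n + 2) then insert i (?Z i j) else ?Z i j)"
        by (auto simp: hit_def less_Suc_eq)
      have upd: "mem A (?Z i (Suc j)) {} [] (if xs ! (i + 2) = xs ! (j + n + 2) then M2(marks + i := Suc 0) else M2)"
        unfolding Suc using m mem_write_mark[OF m i(1)] by simp
      have "wp W mark_body (\<lambda>R3 M3. R3 14 = j \<and> R3 15 = 2 * k \<and> ?J (Suc j) (R3(14 := Suc j)) M3) R2 M2"
        using J j i rd jb upd bounds
        by (simp add: mark_body_def state_simps split: if_splits)
      then show "halts W mark_body R2 M2 (cost mark_body)
          (\<lambda>R3 M3. R3 14 = j \<and> R3 15 = 2 * k \<and> ?J (Suc j) (R3(14 := Suc j)) M3)"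
        by (rule halts_wp)
    qed (use kW in auto)
    moreover have "?Z i (2 * k) = {a. a < Suc i \<and> hit a (2 * k)}" by (auto simp: less_Suc_eq)
    ultimately show "halts W (for_loop 14 15 mark_body) R1 M1 (2 * k * (cost mark_body + 2) + 2)
        (\<lambda>R2 M2. R2 8 = i \<and> R2 0 = n \<and> ?I (Suc i) (R2(8 := Suc i)) M2)"
      by (elim halts_mono) (simp_all add: state_simps)
  qed (use bounds in auto)
  moreover have "n * ((2 * k * (cost mark_body + 2) + 2) + 2) + 2 \<le> mark_time n"
  proof -
    have "2 * k * (cost mark_body + 2) \<le> 2 * n * (cost mark_body + 2)"
      using k_le by (intro mult_right_mono) auto
    then have "(2 * k * (cost mark_body + 2) + 2) + 2 \<le> 2 * n * (cost mark_body + 2) + 4"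
      by linarith
    then show ?thesis unfolding mark_time_def by (intro add_right_mono mult_left_mono) auto
  qed
  ultimately show ?thesis unfolding mark_def by (elim halts_mono) (auto simp: ends_def)
qed

lemma halts_prepare:
  assumes "mem A {} {} [] M" "M 0 = n" "M 1 = k"
  shows "halts W prepare (\<lambda>_. 0) M (cost prepare) (\<lambda>R' M'. state A {} {} [] R' M' \<and> R' 15 = 2 * k)"
proof (rule halts_wp)
  have "2 * k < W" "2 * k + n < W" "2 * k + n + 2 < W"
    using bounds(13,14,15)[of "2 * k"] k_le by simp_all
  then show "wp W prepare (\<lambda>R' M'. state A {} {} [] R' M' \<and> R' 15 = 2 * k) (\<lambda>_. 0) M"
    using assms bounds(2,3,17-20)
    by (simp add: prepare_def state_simps base_def marks_def seen_def stack_def)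
qed

text \<open>A contraction isolates a vertex, which pays for the restart of the search.\<close>

definition potential :: "(nat \<Rightarrow> nat \<Rightarrow> bool) \<Rightarrow> nat set \<Rightarrow> nat list \<Rightarrow> nat" where
  "potential A V st = card (non_isolated n A) * (2 * n + 1) + 2 * (n - card V) + length st + 1"

text \<open>\<open>E\<close> stands for whatever contraction is to preserve; this separates the
  analysis of the program from the snake. The value 0 is reserved for the finished search, since
  every \<open>potential\<close> is positive.\<close>

definition searching :: "'a list \<Rightarrow> nat set \<Rightarrow> ((nat \<Rightarrow> nat \<Rightarrow> bool) \<Rightarrow> bool) \<Rightarrow> nat \<Rightarrow>
    (nat \<Rightarrow> nat) \<Rightarrow> (nat \<Rightarrow> nat) \<Rightarrow> bool" where
  "searching vs Z E p R M \<longleftrightarrow>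
     (\<exists>A V st. state A Z V st R M \<and> dfs_inv vs Z k A V st \<and> E A \<and> p = potential A V st) \<or>
     p = 0 \<and> R 7 = 1 \<and> (\<exists>A. mem A Z {..<n} [] M \<and> dfs_inv vs Z k A {..<n} [] \<and> E A)"

lemma searchingI:
  "state A Z V st R M \<Longrightarrow> dfs_inv vs Z k A V st \<Longrightarrow> E A \<Longrightarrow> searching vs Z E (potential A V st) R M"
  unfolding searching_def by blast

lemma searching_finished:
  "searching vs Z E p R M \<Longrightarrow> R 7 \<noteq> 0 \<Longrightarrow> \<exists>A. mem A Z {..<n} [] M \<and> dfs_inv vs Z k A {..<n} [] \<and> E A"
  unfolding searching_def state_def by blast

lemma halts_dfs_step:
  assumes vs: "length vs = n" "distinct vs" and Z: "Z \<subseteq> {..<n}"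
    and E: "\<And>A V st w i. dfs_inv vs Z k A V st \<Longrightarrow> st \<noteq> [] \<Longrightarrow> w < n \<Longrightarrow> w \<notin> V \<Longrightarrow> A (hd st) w \<Longrightarrow>
      k \<le> i \<Longrightarrow> i < length st \<Longrightarrow> A w (st ! i) \<Longrightarrow> E A \<Longrightarrow> E (contract A (hd st) w)"
    and search: "searching vs Z E p R M" "R 7 = 0"
  shows "halts W dfs_step R M (step_time n) (\<lambda>R' M'. \<exists>p'<p. searching vs Z E p' R' M')"
proof -
  let ?Q = "\<lambda>R' M'. \<exists>p'<p. searching vs Z E p' R' M'"
  obtain A V st where st: "state A Z V st R M" and inv: "dfs_inv vs Z k A V st" and EA: "E A"
    and p: "p = potential A V st"
    using search unfolding searching_def by fastforce
  have A: "simple_rel n A" and V: "Z \<subseteq> V" "V \<subseteq> {..<n}" "distinct st" "set st \<subseteq> V - Z"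
    using dfs_invD[OF inv] vs by simp_all
  have stn: "set st \<subseteq> {..<n}" using V by auto
  have len: "length st \<le> n"
    using card_mono[OF _ stn] V(3) by (simp add: distinct_card)
  have finV: "finite V" using V(2) finite_subset by auto
  have 1: "halts W find R M (find_time n)
    (\<lambda>R' M'. M' = M \<and> state A Z V st R' M \<and> (st \<noteq> [] \<longrightarrow> R' 12 = hd st) \<and>
      (R' 9 = n \<and> (\<forall>w. \<not> candidate A V st w) \<or> candidate A V st (R' 9)))"
    unfolding find_time_def by (rule halts_find[OF st stn len])
  have stop: "halts W pop_or_stop R' M (cost pop_or_stop) ?Q"
    if R': "state A Z V st R' M" and none: "\<forall>w. \<not> candidate A V st w" for R'
  proof (rule halts_wp)
    show "wp W pop_or_stop ?Q R' M"
    proof (cases st)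
      case Nil
      then have "V = {..<n}" using none V by (auto simp: candidate_def)
      then have "mem A Z {..<n} [] M" "dfs_inv vs Z k A {..<n} []"
        using R' inv Nil by (simp_all add: state_def)
      then have "searching vs Z E 0 (R'(7 := Suc 0)) M"
        unfolding searching_def using EA by (intro disjI2 conjI exI[of _ A]) simp_all
      moreover have "0 < p" using p by (simp add: potential_def)
      ultimately have "?Q (R'(7 := Suc 0)) M" by blast
      moreover have "R' 6 = 0" using R' Nil by (simp add: state_def)
      ultimately show ?thesis using bounds(3) by (simp add: pop_or_stop_def)
    next
      case (Cons v st')
      have "dfs_inv vs Z k A V st'"
      proof (rule dfs_inv_pop)
        show "dfs_inv vs Z k A V (v # st')" using inv Cons by simp
        show "b \<in> V" if "b < length vs" "A v b" for b
          using none that vs Cons by (auto simp: candidate_def)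
      qed
      moreover have "state A Z V st' (R'(6 := length st')) M"
        using R' Cons mem_pop by (auto simp: state_simps)
      ultimately have "searching vs Z E (potential A V st') (R'(6 := length st')) M"
        using EA by (intro searchingI)
      moreover have "potential A V st' < p" using p Cons by (simp add: potential_def)
      moreover have "length st' < W" using len Cons bounds(1) by simp
      ultimately have "?Q (R'(6 := length st')) M" "length st' < W" by blast+
      moreover have "R' 6 = Suc (length st')" using R' Cons by (simp add: state_def)
      ultimately show ?thesis by (simp add: pop_or_stop_def)
    qed
  qed
  have advance: "halts W (Seq far (Branch (Equal (Reg 13) (Const 1)) (Seq merge reset) push)) R' M
      (far_time n + (1 + (merge_time n + reset_time n + cost push))) ?Q"
    if R': "state A Z V st R' M" and cand: "candidate A V st w" and R9: "R' 9 = w"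
      and R12: "st \<noteq> [] \<Longrightarrow> R' 12 = hd st" for R' w
  proof -
    have w: "w < n" "w \<notin> V" "st = [] \<or> A (hd st) w" using cand by (auto simp: candidate_def)
    let ?far = "\<exists>i. k \<le> i \<and> i < length st \<and> A w (st ! i)"
    have 2: "halts W far R' M (far_time n)
      (\<lambda>R1 M1. M1 = M \<and> state A Z V st R1 M \<and> R1 9 = w \<and> R1 12 = R' 12 \<and> R1 13 = of_bool ?far)"
      unfolding far_time_def by (rule halts_far[OF R' stn len R9 w(1)])
    have 3: "halts W (Branch (Equal (Reg 13) (Const 1)) (Seq merge reset) push) R1 M
        (1 + (merge_time n + reset_time n + cost push)) ?Q"
      if R1: "state A Z V st R1 M" "R1 9 = w" "R1 12 = R' 12" "R1 13 = of_bool ?far" for R1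
    proof (rule halts_Branch)
      assume "cond_val R1 (Equal (Reg 13) (Const 1))"
      then have ?far using R1(4) by (cases ?far) simp_all
      then obtain i where i: "k \<le> i" "i < length st" "A w (st ! i)" by blast
      let ?u = "hd st" let ?B = "contract A (hd st) w"
      have st0: "st \<noteq> []" using i by auto
      have "?u \<in> V" "?u \<in> {..<n}" using hd_in_set[OF st0] V stn by blast+
      then have u: "R1 12 = ?u" "?u < n" "?u \<noteq> w" "A ?u w"
        using R1(3) R12 st0 w by auto
      have wu: "A w ?u" using simple_rel_sym[OF A u(2) w(1) u(4)] .
      have "simple_rel (length vs) ?B" using A vs by (simp add: simple_rel_contract)
      then have "dfs_inv vs Z k ?B Z []" using Z vs by (intro dfs_inv_start) auto
      moreover have "E ?B" using E[OF inv st0 w(1,2) u(4) i EA] .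
      \<comment> \<open>The contraction releases at least \<open>2 * n + 1\<close>, which pays for a
        whole new search, and the abandoned one had a positive remainder.\<close>
      moreover have "potential ?B Z [] < p"
      proof -
        have "card (non_isolated n ?B) + 1 \<le> card (non_isolated n A)"
          using card_non_isolated_contract[OF A wu u(2) w(1)] by simp
        then have "(card (non_isolated n ?B) + 1) * (2 * n + 1) \<le> card (non_isolated n A) * (2 * n + 1)"
          by (intro mult_right_mono) auto
        then show ?thesis unfolding p potential_def by (simp add: algebra_simps)
      qed
      ultimately have fin: "?Q R2 M2" if "state ?B Z Z [] R2 M2" for R2 M2
        using that searchingI by blast
      have "halts W (Seq merge reset) R1 M (merge_time n + reset_time n) (state ?B Z Z [])"
      proof (rule halts_Seq)
        show "halts W merge R1 M (merge_time n) (state ?B Z V st)"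
          unfolding merge_time_def by (rule halts_merge[OF A R1(1,2) w(1) u(1-3)])
        show "halts W reset R2 M2 (reset_time n) (state ?B Z Z [])" if "state ?B Z V st R2 M2" for R2 M2
          unfolding reset_time_def by (rule halts_reset[OF that Z V(2)])
      qed
      then show "halts W (Seq merge reset) R1 M (merge_time n + reset_time n + cost push) ?Q"
        by (rule halts_mono) (simp, rule fin)
    next
      assume "\<not> cond_val R1 (Equal (Reg 13) (Const 1))"
      then have "\<not> ?far" using R1(4) by (cases ?far) simp_all
      then have near: "\<And>i. k \<le> i \<Longrightarrow> i < length st \<Longrightarrow> \<not> A w (st ! i)" by blast
      have inv': "dfs_inv vs Z k A (insert w V) (w # st)"
        using inv vs w near by (intro dfs_inv_push) auto
      have "card (insert w V) \<le> card {..<n}" using V w by (intro card_mono) auto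
      then have "card V < n" using w finV by simp
      \<comment> \<open>Visiting a vertex releases 2 and the longer stack takes back 1, which its
        pop will release.\<close>
      then have less: "potential A (insert w V) (w # st) < p"
        unfolding p potential_def using w finV by simp
      have "card (set st) \<le> card V" using V(4) finV by (intro card_mono) auto
      then have "length st < n" using V(3) \<open>card V < n\<close> by (simp add: distinct_card)
      then have "halts W push R1 M (cost push) (state A Z (insert w V) (w # st))"
        using R1 w by (intro halts_push) auto
      then show "halts W push R1 M (merge_time n + reset_time n + cost push) ?Q"
        by (rule halts_mono) (simp, use inv' less EA searchingI in blast)
    qed
    show ?thesis by (rule halts_Seq[OF 2]) (use 3 in blast)
  qed
  show ?thesis
    unfolding dfs_step_def step_time_def
  proof (rule halts_Seq[OF 1], elim conjE)
    fix R' M'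
    assume R': "M' = M" "state A Z V st R' M" "st \<noteq> [] \<longrightarrow> R' 12 = hd st"
      and cand: "R' 9 = n \<and> (\<forall>w. \<not> candidate A V st w) \<or> candidate A V st (R' 9)"
    have n: "R' 0 = n" using R' by (simp add: state_simps)
    show "halts W (Branch (Equal (Reg 9) (Reg 0)) pop_or_stop
        (Seq far (Branch (Equal (Reg 13) (Const 1)) (Seq merge reset) push))) R' M'
      (1 + (cost pop_or_stop + (far_time n + (1 + (merge_time n + reset_time n + cost push))))) ?Q"
    proof (rule halts_Branch)
      assume "cond_val R' (Equal (Reg 9) (Reg 0))"
      then have "\<forall>w. \<not> candidate A V st w" using cand n by (auto simp: candidate_def)
      then show "halts W pop_or_stop R' M' (cost pop_or_stop +
          (far_time n + (1 + (merge_time n + reset_time n + cost push)))) ?Q"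
        unfolding R'(1) by (intro halts_mono[OF stop[OF R'(2)]]) simp_all
    next
      assume "\<not> cond_val R' (Equal (Reg 9) (Reg 0))"
      then have "candidate A V st (R' 9)" using cand n by auto
      then show "halts W (Seq far (Branch (Equal (Reg 13) (Const 1)) (Seq merge reset) push)) R' M'
          (cost pop_or_stop + (far_time n + (1 + (merge_time n + reset_time n + cost push)))) ?Q"
        unfolding R'(1) using R'(3) by (intro halts_mono[OF advance[OF R'(2) _ refl]]) simp_all
    qed
  qed
qed

lemma halts_reduce:
  assumes vs: "length vs = n" "distinct vs" and A: "simple_rel n A" "E A"
    and E: "\<And>A V st w i. dfs_inv vs ends k A V st \<Longrightarrow> st \<noteq> [] \<Longrightarrow> w < n \<Longrightarrow> w \<notin> V \<Longrightarrow> A (hd st) w \<Longrightarrow>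
      k \<le> i \<Longrightarrow> i < length st \<Longrightarrow> A w (st ! i) \<Longrightarrow> E A \<Longrightarrow> E (contract A (hd st) w)"
    and M: "mem A {} {} [] M" "M 0 = n" "M 1 = k"
  shows "halts W reduce (\<lambda>_. 0) M (reduce_time n)
    (\<lambda>R' M'. \<exists>B. mem B ends {..<n} [] M' \<and> dfs_inv vs ends k B {..<n} [] \<and> E B)"
  unfolding reduce_def reduce_time_def
proof (rule halts_Seq[OF halts_prepare[OF M]], rule halts_Seq[OF halts_mark], blast, blast,
    rule halts_Seq)
  fix R M assume st: "state A ends {} [] R M"
  show "halts W reset R M (reset_time n) (state A ends ends [])"
    unfolding reset_time_def by (rule halts_reset[OF st ends_subset]) simp
next
  fix R M assume st: "state A ends ends [] R M"
  have p: "potential A ends [] \<le> steps n"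
  proof -
    have "card (non_isolated n A) \<le> card {..<n}"
      by (intro card_mono) (auto simp: non_isolated_def)
    then have "card (non_isolated n A) * (2 * n + 1) \<le> n * (2 * n + 1)"
      by (intro mult_right_mono) auto
    moreover have "n - card ends \<le> n" by simp
    ultimately show ?thesis unfolding potential_def steps_def list.size by linarith
  qed
  have "dfs_inv vs ends k A ends []" using A vs ends_subset by (intro dfs_inv_start) auto
  then have "searching vs ends E (potential A ends []) R M" using st A(2) by (intro searchingI)
  then have "halts W (While (Equal (Reg 7) (Const 0)) dfs_step) R M
      (potential A ends [] * (step_time n + 1) + 1)
      (\<lambda>R' M'. \<exists>p'. searching vs ends E p' R' M' \<and> \<not> cond_val R' (Equal (Reg 7) (Const 0)))"
  proof (rule halts_While[where I = "searching vs ends E"])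
    fix p R M assume *: "searching vs ends E p R M" "cond_val R (Equal (Reg 7) (Const 0))"
    show "halts W dfs_step R M (step_time n) (\<lambda>R' M'. \<exists>p'<p. searching vs ends E p' R' M')"
      by (rule halts_dfs_step[where E = E and Z = ends, OF vs ends_subset]) (fact E, use * in simp_all)
  qed
  then show "halts W (While (Equal (Reg 7) (Const 0)) dfs_step) R M (steps n * (step_time n + 1) + 1)
      (\<lambda>R' M'. \<exists>B. mem B ends {..<n} [] M' \<and> dfs_inv vs ends k B {..<n} [] \<and> E B)"
  proof (rule halts_mono)
    show "potential A ends [] * (step_time n + 1) + 1 \<le> steps n * (step_time n + 1) + 1"
      using p by (intro add_right_mono mult_right_mono) auto
  qed (use searching_finished in auto)
qed

end

section \<open>Encoded instances and correctness of the reduction\<close>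

lemma nth_concat_map_map:
  assumes "i < length us" "j < length vs"
  shows "concat (map (\<lambda>u. map (f u) vs) us) ! (i * length vs + j) = f (us ! i) (vs ! j)"
  using assms(1)
proof (induction us arbitrary: i)
  case (Cons u us)
  show ?case
  proof (cases i)
    case 0
    then show ?thesis using assms(2) by (simp add: nth_append)
  next
    case (Suc i')
    then show ?thesis using Cons by (simp add: nth_append add.assoc)
  qed
qed simp

lemma length_concat_map_map: "length (concat (map (\<lambda>u. map (f u) vs) us)) = length us * length vs"
  by (induction us) auto

lemma nth_instance_code:
  assumes "length ini = k" "length fin = k"
  shows "length (instance_code vs G k ini fin) = length vs * length vs + (2 * k + length vs + 2)"
    and "i < 2 * k + length vs + 2 \<Longrightarrow>
      instance_code vs G k ini fin ! i = ([length vs, k] @ vs @ ini @ fin) ! i"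
    and "i < length vs \<Longrightarrow> j < length vs \<Longrightarrow>
      instance_code vs G k ini fin ! (i * length vs + j + (2 * k + length vs + 2)) =
        of_bool ({vs ! i, vs ! j} \<in> edges G)"
proof -
  let ?pre = "[length vs, k] @ vs @ ini @ fin"
  let ?mat = "concat (map (\<lambda>u. map (\<lambda>v. if {u, v} \<in> edges G then 1 else (0 :: nat)) vs) vs)"
  have code: "instance_code vs G k ini fin = ?pre @ ?mat" by (simp add: instance_code_def)
  have pre: "length ?pre = 2 * k + length vs + 2" using assms by simp
  show "length (instance_code vs G k ini fin) = length vs * length vs + (2 * k + length vs + 2)"
    unfolding code length_append[of ?pre] pre length_concat_map_map by simp
  show "instance_code vs G k ini fin ! i = ?pre ! i" if "i < 2 * k + length vs + 2"
    unfolding code using that pre nth_append[of ?pre ?mat i] by simp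
  show "instance_code vs G k ini fin ! (i * length vs + j + (2 * k + length vs + 2)) =
        of_bool ({vs ! i, vs ! j} \<in> edges G)" if "i < length vs" "j < length vs"
  proof -
    have "(?pre @ ?mat) ! (i * length vs + j + length ?pre) = ?mat ! (i * length vs + j)"
      by (metis add.commute nth_append_length_plus)
    then show ?thesis unfolding code pre using nth_concat_map_map[OF that, of "\<lambda>u v. if {u, v} \<in> edges G then 1 else (0 :: nat)"] by simp
  qed
qed

theorem theorem5p15:
  "\<exists>(P :: program) (d :: nat) (T :: nat \<Rightarrow> nat) (c :: nat).
     (\<lambda>n. real (T n)) \<in> O(\<lambda>n. real n ^ 3) \<and>
     (\<forall>(G :: nat ugraph) k ini fin xs.
        snake_instance G k ini fin \<and> encodes_instance xs G k ini fin \<longrightarrow>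
        (\<exists>G' ys.
           outputs_within P d xs (T (card (verts G))) ys \<and>
           encodes_instance ys G' k ini fin \<and>
           snake_instance G' k ini fin \<and>
           (yes_instance G k ini fin \<longleftrightarrow> yes_instance G' k ini fin) \<and>
           treewidth G' \<le> c * k ^ c))"
\<comment> \<open>The word parameter 3 is the exponent required by the memory layout. The last 3
  comes from the width bound \<open>3 * k\<close>: \<open>k\<close> vertices of the stack and at
  most \<open>2 * k\<close> of \<open>ini\<close> and \<open>fin\<close>.\<close>
proof (rule exI[of _ reduce], rule exI[of _ 3], rule exI[of _ reduce_time], rule exI[of _ 3],
    intro conjI reduce_time_bigo allI impI, elim conjE)
  fix G :: "nat ugraph" and k ini fin xs
  assume inst: "snake_instance G k ini fin" and "encodes_instance xs G k ini fin"
  then obtain vs where vs: "distinct vs" "set vs = verts G" and xs: "xs = instance_code vs G k ini fin"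
    by (auto simp: encodes_instance_def)
  define n where "n = length vs"
  define W where "W = word_bound 3 xs"
  have card: "card (verts G) = n" using vs distinct_card by (metis n_def)
  have G: "finite_graph G" and conf: "is_conf G k ini" "is_conf G k fin"
    using inst by (auto simp: snake_instance_def)
  have ini: "length ini = k" "length fin = k" "set ini \<subseteq> verts G" "set fin \<subseteq> verts G" "distinct ini"
    using conf by (auto simp: is_conf_def is_path_def)
  have "k \<le> n"
    using card_mono[of "verts G" "set ini"] ini G card by (simp add: finite_graph_def distinct_card)
  moreover have "(n + 2) ^ 3 \<le> W"
  proof -
    \<comment> \<open>The number of vertices is itself an entry of the input, so words are long
      enough however small the vertex names are.\<close>
    have "n \<in> set xs" by (simp add: xs instance_code_def n_def)
    then have "n \<le> Max (set xs)" by simp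
    then show ?thesis unfolding W_def word_bound_def by (intro power_mono) auto
  qed
  ultimately interpret layout n k W xs by unfold_locales
  note instance_nth = nth_instance_code[OF ini(1,2), where vs = vs]
  have code_length: "length (instance_code vs H k ini fin) = n * n + base" for H :: "nat ugraph"
    unfolding base_def unfolding n_def by (rule instance_nth)
  have code_prefix: "instance_code vs H k ini fin ! i = ([n, k] @ vs @ ini @ fin) ! i"
    if "i < base" for H :: "nat ugraph" and i
    using that unfolding base_def unfolding n_def by (rule instance_nth)
  have code_cell: "instance_code vs H k ini fin ! (i * n + j + base) = of_bool ({vs ! i, vs ! j} \<in> edges H)"
    if "i < n" "j < n" for H :: "nat ugraph" and i j
    using that unfolding base_def unfolding n_def by (rule instance_nth)
  define A where "A i j \<longleftrightarrow> i < n \<and> j < n \<and> {vs ! i, vs ! j} \<in> edges G" for i j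
  define M where "M i = (if i < length xs then xs ! i else 0)" for i
  have simple: "simple_rel n A"
    using G unfolding simple_rel_def A_def finite_graph_def by (auto simp: insert_commute)
  have "edges (index_graph vs A) = edges G"
  proof (intro equalityI subsetI)
    fix e assume e: "e \<in> edges G"
    then have "e \<subseteq> set vs" "card e = 2" using G vs by (auto simp: finite_graph_def)
    then obtain u v where "e = {u, v}" "u \<in> set vs" "v \<in> set vs" by (auto simp: card_2_iff)
    then obtain i j where "e = {vs ! i, vs ! j}" "i < n" "j < n" by (auto simp: in_set_conv_nth n_def)
    then show "e \<in> edges (index_graph vs A)" using e by (auto simp: index_graph_def A_def n_def)
  qed (auto simp: index_graph_def A_def)
  then have GA: "index_graph vs A = G"
    using vs by (intro ugraph.equality) (auto simp: index_graph_def)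
  have lenxs: "length xs = n * n + base" unfolding xs by (rule code_length)
  have mem: "mem A {} {} [] M"
    unfolding mem_def
  proof (intro conjI allI impI)
    fix i j assume ij: "i < n" "j < n"
    have "xs ! (i * n + j + base) = of_bool (A i j)" unfolding xs using code_cell ij by (simp add: A_def)
    then show "M (i * n + j + base) = of_bool (A i j)"
      using cell_less[OF ij] by (simp add: M_def lenxs)
  qed (auto simp: M_def lenxs marks_def seen_def)
  have pre: "i < base \<Longrightarrow> xs ! i = ([n, k] @ vs @ ini @ fin) ! i" for i
    unfolding xs by (rule code_prefix)
  have M01: "M 0 = n" "M 1 = k" using pre[of 0] pre[of 1] by (auto simp: M_def lenxs base_def)
  have ends: "ends = {i. i < n \<and> vs ! i \<in> set ini \<union> set fin}"
  proof -
    have "hit i (2 * k) \<longleftrightarrow> vs ! i \<in> set ini \<union> set fin" if "i < n" for i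
    proof -
      have "xs ! (i + 2) = vs ! i"
      proof -
        have "i + 2 < base" using that by (simp add: base_def)
        from pre[OF this] show ?thesis using that by (simp add: nth_append n_def)
      qed
      moreover have "xs ! (l + n + 2) = (ini @ fin) ! l" if "l < 2 * k" for l
      proof -
        have "l + n + 2 < base" using that by (simp add: base_def)
        from pre[OF this] show ?thesis
          using nth_append_length_plus[of vs "ini @ fin" l] by (simp add: n_def add.commute)
      qed
      ultimately have "hit i (2 * k) \<longleftrightarrow> (\<exists>l<2 * k. vs ! i = (ini @ fin) ! l)"
        unfolding hit_def by auto
      also have "\<dots> \<longleftrightarrow> vs ! i \<in> set (ini @ fin)"
      proof -
        have "2 * k = length (ini @ fin)" using ini by simp
        then show ?thesis unfolding in_set_conv_nth by metis
      qed
      finally show ?thesis by simp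
    qed
    then show ?thesis by (auto simp: ends_def)
  qed
  \<comment> \<open>The first part keeps \<open>ini\<close> and \<open>fin\<close> configurations,
    the second keeps the answer; for \<open>k \<le> 1\<close> the answer is always yes.\<close>
  let ?E = "\<lambda>B. (\<forall>a\<in>ends. \<forall>b\<in>ends. B a b \<longleftrightarrow> A a b) \<and>
    (2 \<le> k \<longrightarrow> (can_reach (index_graph vs B) k ini fin \<longleftrightarrow> can_reach G k ini fin))"
  have step: "?E (contract B (hd st) w)"
    if B: "dfs_inv vs ends k B V st" "st \<noteq> []" "w < n" "w \<notin> V" "B (hd st) w"
      "k \<le> i" "i < length st" "B w (st ! i)" "?E B" for B V st w i
  proof -
    note inv = dfs_invD[OF B(1)]
    have hd: "hd st \<in> set st" using B(2) by simp
    \<comment> \<open>Neither \<open>w\<close> nor \<open>hd st\<close> is in \<open>ends\<close>,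
      so contraction leaves the entries between vertices of \<open>ini\<close> and
      \<open>fin\<close> alone.\<close>
    have off: "w \<notin> ends" "set st \<inter> ends = {}" using inv B(4) by auto
    then have "contract B (hd st) w a b \<longleftrightarrow> B a b" if "a \<in> ends" "b \<in> ends" for a b
      using that hd by (auto simp: contract_def)
    moreover have "can_reach (index_graph vs (contract B (hd st) w)) k ini fin \<longleftrightarrow>
        can_reach (index_graph vs B) k ini fin" if k: "2 \<le> k"
    proof (rule can_reach_contract[OF inv(1) vs(1) k _ inv(6) _ B(2) refl _ B(6-8)])
      show "distinct (w # st)" using inv B(4) by auto
      show sub: "set (w # st) \<subseteq> {..<length vs}" using inv B(3) by (auto simp: n_def)
      show "B w (hd st)"
        using simple_rel_sym[OF inv(1), of "hd st" w] sub hd B(5) by auto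
      have "vs ! a \<notin> set ini \<union> set fin" if "a \<in> set (w # st)" for a
      proof -
        have "a \<notin> ends" using that off by auto
        moreover have "a < n" using that sub unfolding n_def by auto
        ultimately show ?thesis by (simp add: ends)
      qed
      then show "set ini \<inter> (!) vs ` set (w # st) = {}" "set fin \<inter> (!) vs ` set (w # st) = {}"
        by blast+
    qed
    ultimately show ?thesis using B(9) by blast
  qed
  have "halts W reduce (\<lambda>_. 0) M (reduce_time n)
    (\<lambda>R' M'. \<exists>B. mem B ends {..<n} [] M' \<and> dfs_inv vs ends k B {..<n} [] \<and> ?E B)"
    by (rule halts_reduce[where E = ?E, OF n_def[symmetric] vs(1) simple _ step mem M01])
      (simp_all add: GA)
  then obtain t R' M' B where run: "t \<le> reduce_time n" "exec W reduce (\<lambda>_. 0, M) t (R', M')"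
    and memB: "mem B ends {..<n} [] M'" and inv: "dfs_inv vs ends k B {..<n} []" and E: "?E B"
    unfolding halts_def by blast
  define G' where "G' = index_graph vs B"
  define ys where "ys = instance_code vs G' k ini fin"
  have B: "simple_rel (length vs) B" by (rule dfs_invD[OF inv])
  have G': "finite_graph G'" unfolding G'_def by (rule finite_graph_index_graph[OF B vs(1)])
  have conf': "is_conf G' k c" if c: "is_conf G k c" "set c \<subseteq> set ini \<union> set fin" for c
  proof -
    have "{u, v} \<in> edges G'" if "u \<in> set c" "v \<in> set c" "{u, v} \<in> edges G" for u v
    proof -
      have "u \<in> set vs" "v \<in> set vs" using that c ini vs by auto
      then obtain i j where ij: "i < n" "j < n" "u = vs ! i" "v = vs ! j"
        by (auto simp: in_set_conv_nth n_def)
      then have "i \<in> ends" "j \<in> ends" using that c by (auto simp: ends)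
      then have "B i j" using E ij that by (auto simp: A_def)
      then show ?thesis using ij by (auto simp: G'_def index_graph_def n_def)
    qed
    then have "successively (\<lambda>u v. {u, v} \<in> edges G') c"
      using c by (auto simp: is_conf_def is_path_def intro: successively_mono)
    then show ?thesis using c vs by (auto simp: is_conf_def is_path_def G'_def)
  qed
  have inst': "snake_instance G' k ini fin"
    using G' conf conf' by (simp add: snake_instance_def)
  have "outputs_within reduce 3 xs (reduce_time (card (verts G))) ys"
  proof -
    have "M' i = ys ! i" if i: "i < length ys" for i
    proof (cases "i < base")
      case True
      \<comment> \<open>In front of the matrix, the encoding depends only on \<open>vs\<close>,
        \<open>k\<close>, \<open>ini\<close> and \<open>fin\<close>, so the unchanged input cells
        are already correct output.\<close>
      then have "ys ! i = xs ! i" unfolding ys_def using code_prefix pre by simp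
      then show ?thesis using mem_read(1)[OF memB] True by simp
    next
      case False
      define q where "q = i - base"
      have q: "i = q + base" "q < n * n" using False i code_length by (auto simp: q_def ys_def)
      then have n0: "0 < n" by (cases n) auto
      have ab: "q div n < n" "q mod n < n" using q n0 by (simp_all add: less_mult_imp_div_less)
      have "i = q div n * n + q mod n + base" using q by simp
      moreover have "M' (q div n * n + q mod n + base) = of_bool (B (q div n) (q mod n))"
        by (rule mem_read(2)[OF memB ab])
      moreover have "ys ! (q div n * n + q mod n + base) = of_bool (B (q div n) (q mod n))"
        unfolding ys_def using code_cell[OF ab] edge_index_graph[OF B vs(1)] ab by (simp add: G'_def n_def)
      ultimately show ?thesis by simp
    qed
    moreover have "(\<lambda>_. 0, M) = initial_state xs" by (auto simp: initial_state_def M_def)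
    ultimately show ?thesis
      using run by (auto simp: outputs_within_def memory_starts_with_def card W_def)
  qed
  moreover have "encodes_instance ys G' k ini fin"
    using vs by (auto simp: encodes_instance_def ys_def G'_def)
  moreover have "yes_instance G k ini fin \<longleftrightarrow> yes_instance G' k ini fin"
  proof (cases "2 \<le> k")
    case True
    then show ?thesis using E inst inst' by (simp add: yes_instance_def G'_def)
  next
    case False
    then have "k \<le> 1" by simp
    then show ?thesis
      using can_reach_trivial inst inst' by (auto simp: yes_instance_def snake_instance_def)
  qed
  moreover have "treewidth G' \<le> 3 * k ^ 3"
  proof -
    have endsD: "a < length vs" "vs ! a \<in> set ini \<union> set fin" if "a \<in> ends" for a
      using that unfolding ends by (auto simp: n_def)
    have "card ends \<le> card (set ini \<union> set fin)"
    proof (rule card_inj_on_le)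
      show "inj_on ((!) vs) ends"
        using vs(1) endsD(1) by (intro inj_onI) (simp add: nth_eq_iff_index_eq)
    qed (use endsD(2) in auto)
    also have "\<dots> \<le> 2 * k"
      using card_Un_le[of "set ini" "set fin"] card_length[of ini] card_length[of fin] ini by simp
    finally have "treewidth G' \<le> 3 * k"
      using treewidth_dfs_inv[OF inv _ vs(1)] by (simp add: G'_def n_def)
    also have "k \<le> k ^ 3" by (cases k) (auto simp: power3_eq_cube)
    then have "3 * k \<le> 3 * k ^ 3" by simp
    finally show ?thesis .
  qed
  ultimately show "\<exists>G' ys. outputs_within reduce 3 xs (reduce_time (card (verts G))) ys \<and>
      encodes_instance ys G' k ini fin \<and> snake_instance G' k ini fin \<and>
      (yes_instance G k ini fin \<longleftrightarrow> yes_instance G' k ini fin) \<and> treewidth G' \<le> 3 * k ^ 3"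
    using inst' by blast
qed

end
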